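(* Let $g$ be an $n$-stranded non-crossing glider. The following are equivalent: 1. $g$ is pure. 2. $g$ is a nested $n$-stranded glider under a turning rule. 3. $g$ is a nested $n$-stranded glider.
   Context: **Cells.** A cell has a left and a right slot and is of one of eight types: $[n,n]$ (empty); $[s,n]$, $[n,s]$, $[s,s]$; $[r,n]$; $[n,l]$; $[r,l]$ (a Z-crossing); $\overline{[r,l]}$ (an S-crossing). The symbols $s,r,l$ are strands (straight, turning right, turning left); $n$ means no strand. A cell has state E if it is empty, S if it contains an $s$, T if it contains an $r$ or an $l$. A strand exits its cell to the left if it is an $s$ in the left slot or an $l$; it exits to the right if it is an $s$ in the right slot or an $r$. **Generations.** A generation with $n$ strands is a map $\delta$ from $\mathbb Z$ to cell types containing exactly $n$ strands in total, with $\delta(0)$ nonempty and $\delta(j)$ empty for $j<0$ (so generations are recorded up to horizontal translation). It is written as the string of cells $\delta(0)\delta(1)\cdots\delta(m)$, where $\delta(m)$ is the last nonempty cell. Strand $k$ of $\delta$ is the $k$-th strand from the left. **Grid patterns.** An ($n$-stranded) grid pattern is a finite or infinite list $g=[\delta_1,\delta_2,\dots]$ of generations with $n$ strands. For consecutive generations $\delta,\delta'$, the child of the adjacent cells $\delta(k),\delta(k+1)$ is $\delta'(k+1)$ if some strand of $\delta(0)$ exits to the left, and $\delta'(k)$ otherwise. The pattern is continuous if for all consecutive generations $\delta,\delta'$ and all $k$, the child of $\delta(k),\delta(k+1)$ has its left slot occupied iff a strand of $\delta(k)$ exits to the right, and its right slot occupied iff a strand of $\delta(k+1)$ exits to the left.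 Composition of patterns is concatenation of lists; $a^\infty$ is $a$ repeated infinitely often. If $g$ is of the form $a^\infty$, $\operatorname{per}(g)$ is the shortest $a$ with $g=a^\infty$, and $|\operatorname{per}(g)|$ is its number of generations. **Rules.** A turning rule is a string $t=t_0t_1\cdots t_8\in\{0,1\}^9$ with $t_4=0$; the bits $0,1,\dots,8$ correspond in order to the pairs SS, SE, ST, ES, EE, ET, TS, TE, TT. It is a turning rule of a continuous pattern $g$ if, whenever adjacent cells $A,B$ (left, right) of a generation have a nonempty child $C$ in the next generation and the pair (state of $A$, state of $B$) corresponds to bit $i$, then $C$ has state T if $t_i=1$ and state S if $t_i=0$. A crossing rule assigns a bit (Z- or S-crossing) to each of the nine pairs of crossing statuses (none, Z, S) of $A,B$, and prescribes the type of any child that is a crossing. An SCA pattern is a continuous grid pattern that has a turning rule and a crossing rule. **Speed.** For a generation $\delta$ put $e(\delta)=1$ if $\delta(0)=[n,l]$, $e(\delta)=-1$ if $\delta(0)=[r,n]$, and $e(\delta)=0$ otherwise. The speed of $g=a^\infty$ with $a=\operatorname{per}(g)$ is the symbol $\frac{d}{|a|}$ with $d=\sum_{\delta\in a}e(\delta)$; it is positive, negative or zero according to $d$. **Repeating patterns and gliders.** A null chain in $a=[\delta_1,\dots,\delta_k]$ is a sequence of empty cells $C_1,\dots,C_k$, $C_i$ a cell of $\delta_i$, such that $\delta_1$ has nonempty cells both to the left and to the right of $C_1$, and each $C_{i+1}$ is the child of $C_i$ and one of its two horizontal neighbours. A repeating SCA pattern is an SCA pattern of the form $g=a^\infty$,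 $a=\operatorname{per}(g)$, such that $a$ has no null chain. A glider is a repeating SCA pattern of nonzero speed. **Non-crossing, subpatterns, pure, nested.** A pattern is non-crossing if no generation contains a crossing ($[r,l]$ or $\overline{[r,l]}$). For a non-crossing $n$-stranded pattern $g$ and $1\le k\le n$, $g_k^l$ (resp. $g_k^r$) is the $k$-stranded pattern obtained by deleting, in every generation, all strands except the first (resp. last) $k$ from the left, and renormalizing generations. A pure glider is a glider of positive speed having a turning rule with bit 1 (SE) equal to 0, or a glider of negative speed having a turning rule with bit 3 (ES) equal to 0. A nested $n$-stranded glider is a glider of positive speed such that $g_k^l$ is a glider for all $1\le k\le n$, or a glider of negative speed such that $g_k^r$ is a glider for all $1\le k\le n$. It is a nested $n$-stranded glider under a turning rule if moreover there is a single $t$ that is a turning rule of all the $g_k^l$ (positive case), resp. all the $g_k^r$ (negative case), $1\le k\le n$. *)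

theory Defs
  imports Main "HOL-Library.Stream"
begin

section \<open>Cells\<close>

text \<open>The name lists the left and the right slot; \<open>RL_Z\<close> and \<open>RL_S\<close> are the Z-crossing
  and the S-crossing.\<close>

datatype cell = N_N | S_N | N_S | S_S | R_N | N_L | RL_Z | RL_S

datatype cell_state = St_S | St_E | St_T

datatype crossing_status = No_Crossing | Z_Crossing | S_Crossing

definition left_occupied :: "cell \<Rightarrow> bool" where
  "left_occupied c \<longleftrightarrow> c \<in> {S_N, S_S, R_N, RL_Z, RL_S}"

definition right_occupied :: "cell \<Rightarrow> bool" where
  "right_occupied c \<longleftrightarrow> c \<in> {N_S, S_S, N_L, RL_Z, RL_S}"

text \<open>Whether some strand of the cell exits to the left, resp. right.\<close>

definition exits_left :: "cell \<Rightarrow> bool" where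
  "exits_left c \<longleftrightarrow> c \<in> {S_N, S_S, N_L, RL_Z, RL_S}"

definition exits_right :: "cell \<Rightarrow> bool" where
  "exits_right c \<longleftrightarrow> c \<in> {N_S, S_S, R_N, RL_Z, RL_S}"

definition is_crossing :: "cell \<Rightarrow> bool" where
  "is_crossing c \<longleftrightarrow> c \<in> {RL_Z, RL_S}"

fun state_of :: "cell \<Rightarrow> cell_state" where
  "state_of N_N = St_E"
| "state_of S_N = St_S"
| "state_of N_S = St_S"
| "state_of S_S = St_S"
| "state_of R_N = St_T"
| "state_of N_L = St_T"
| "state_of RL_Z = St_T"
| "state_of RL_S = St_T"

definition crossing_status_of :: "cell \<Rightarrow> crossing_status" where
  "crossing_status_of c =
     (if c = RL_Z then Z_Crossing else if c = RL_S then S_Crossing else No_Crossing)"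

definition cell_strands :: "cell \<Rightarrow> nat" where
  "cell_strands c = of_bool (left_occupied c) + of_bool (right_occupied c)"


section \<open>Generations and grid patterns\<close>

type_synonym generation = "int \<Rightarrow> cell"

definition strands_in :: "generation \<Rightarrow> int set \<Rightarrow> nat" where
  "strands_in \<delta> A = (\<Sum>j\<in>{j \<in> A. \<delta> j \<noteq> N_N}. cell_strands (\<delta> j))"

definition is_generation :: "nat \<Rightarrow> generation \<Rightarrow> bool" where
  "is_generation n \<delta> \<longleftrightarrow>
     finite {j. \<delta> j \<noteq> N_N} \<and> strands_in \<delta> UNIV = n \<and> \<delta> 0 \<noteq> N_N \<and> (\<forall>j<0. \<delta> j = N_N)"

text \<open>The position, in the next generation, of the child of \<open>\<delta> k\<close> and \<open>\<delta> (k + 1)\<close>.\<close>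

definition child_pos :: "generation \<Rightarrow> int \<Rightarrow> int" where
  "child_pos \<delta> k = (if exits_left (\<delta> 0) then k + 1 else k)"

text \<open>Only infinite patterns are modelled, since patterns of the form \<open>a\<^sup>\<infinity>\<close>, and hence
  gliders and their subpatterns, are infinite.\<close>

type_synonym pattern = "generation stream"

text \<open>The child of \<open>(g !! i) k\<close> and \<open>(g !! i) (k + 1)\<close>.\<close>

definition child :: "pattern \<Rightarrow> nat \<Rightarrow> int \<Rightarrow> cell" where
  "child g i k = (g !! Suc i) (child_pos (g !! i) k)"

definition grid_pattern :: "nat \<Rightarrow> pattern \<Rightarrow> bool" where
  "grid_pattern n g \<longleftrightarrow> (\<forall>i. is_generation n (g !! i))"

definition continuous_pattern :: "pattern \<Rightarrow> bool" where
  "continuous_pattern g \<longleftrightarrow>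
     (\<forall>i k. (left_occupied (child g i k) \<longleftrightarrow> exits_right ((g !! i) k)) \<and>
            (right_occupied (child g i k) \<longleftrightarrow> exits_left ((g !! i) (k + 1))))"

definition non_crossing :: "pattern \<Rightarrow> bool" where
  "non_crossing g \<longleftrightarrow> (\<forall>i k. \<not> is_crossing ((g !! i) k))"


section \<open>Rules\<close>

fun state_index :: "cell_state \<Rightarrow> nat" where
  "state_index St_S = 0"
| "state_index St_E = 1"
| "state_index St_T = 2"

text \<open>This numbers the pairs SS, SE, ST, ES, EE, ET, TS, TE, TT from 0 to 8.\<close>

definition bit_index :: "cell_state \<Rightarrow> cell_state \<Rightarrow> nat" where
  "bit_index A B = 3 * state_index A + state_index B"

definition turning_rule :: "bool list \<Rightarrow> bool" where
  "turning_rule t \<longleftrightarrow> length t = 9 \<and> \<not> t ! 4"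

definition turning_rule_of :: "bool list \<Rightarrow> pattern \<Rightarrow> bool" where
  "turning_rule_of t g \<longleftrightarrow> turning_rule t \<and>
     (\<forall>i k. child g i k \<noteq> N_N \<longrightarrow>
        state_of (child g i k) =
          (if t ! bit_index (state_of ((g !! i) k)) (state_of ((g !! i) (k + 1)))
           then St_T else St_S))"

text \<open>In a crossing rule, \<open>True\<close> prescribes an S-crossing and \<open>False\<close> a Z-crossing.\<close>

type_synonym crossing_rule = "crossing_status \<Rightarrow> crossing_status \<Rightarrow> bool"

definition crossing_rule_of :: "crossing_rule \<Rightarrow> pattern \<Rightarrow> bool" where
  "crossing_rule_of c g \<longleftrightarrow>
     (\<forall>i k. is_crossing (child g i k) \<longrightarrow>
        child g i k =
          (if c (crossing_status_of ((g !! i) k)) (crossing_status_of ((g !! i) (k + 1)))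
           then RL_S else RL_Z))"

definition sca_pattern :: "nat \<Rightarrow> pattern \<Rightarrow> bool" where
  "sca_pattern n g \<longleftrightarrow> grid_pattern n g \<and> continuous_pattern g \<and>
     (\<exists>t. turning_rule_of t g) \<and> (\<exists>c. crossing_rule_of c g)"


section \<open>Periods, speed, gliders\<close>

definition periodic :: "pattern \<Rightarrow> bool" where
  "periodic g \<longleftrightarrow> (\<exists>a. a \<noteq> [] \<and> g = cycle a)"

definition per :: "pattern \<Rightarrow> generation list" where
  "per g = (ARG_MIN length a. a \<noteq> [] \<and> g = cycle a)"

definition lead_shift :: "generation \<Rightarrow> int" where
  "lead_shift \<delta> = (if \<delta> 0 = N_L then 1 else if \<delta> 0 = R_N then -1 else 0)"

text \<open>The pair \<open>(d, m)\<close> stands for the unreduced symbol \<open>d / m\<close>.\<close>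

definition speed :: "pattern \<Rightarrow> int \<times> nat" where
  "speed g = (\<Sum>\<delta>\<leftarrow>per g. lead_shift \<delta>, length (per g))"

definition positive_speed :: "pattern \<Rightarrow> bool" where
  "positive_speed g \<longleftrightarrow> fst (speed g) > 0"

definition negative_speed :: "pattern \<Rightarrow> bool" where
  "negative_speed g \<longleftrightarrow> fst (speed g) < 0"

text \<open>The list \<open>cs\<close> gives the positions of the cells of the chain. The children of the cell
  at position \<open>p\<close> with its right and left neighbour are at \<open>child_pos \<delta> p\<close> and
  \<open>child_pos \<delta> (p - 1)\<close>.\<close>

definition null_chain :: "generation list \<Rightarrow> int list \<Rightarrow> bool" where
  "null_chain a cs \<longleftrightarrow> a \<noteq> [] \<and> length cs = length a \<and>
     (\<forall>i<length a. (a ! i) (cs ! i) = N_N) \<and>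
     (\<exists>j<cs ! 0. (a ! 0) j \<noteq> N_N) \<and> (\<exists>j>cs ! 0. (a ! 0) j \<noteq> N_N) \<and>
     (\<forall>i. Suc i < length a \<longrightarrow>
        cs ! Suc i = child_pos (a ! i) (cs ! i) \<or>
        cs ! Suc i = child_pos (a ! i) (cs ! i - 1))"

definition repeating_sca_pattern :: "nat \<Rightarrow> pattern \<Rightarrow> bool" where
  "repeating_sca_pattern n g \<longleftrightarrow>
     sca_pattern n g \<and> periodic g \<and> (\<nexists>cs. null_chain (per g) cs)"

definition glider :: "nat \<Rightarrow> pattern \<Rightarrow> bool" where
  "glider n g \<longleftrightarrow> repeating_sca_pattern n g \<and> (positive_speed g \<or> negative_speed g)"


section \<open>Subpatterns\<close>

text \<open>\<open>keep l r c\<close> deletes the strand in the left slot of \<open>c\<close> unless \<open>l\<close>, and the one in the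
  right slot unless \<open>r\<close>.\<close>

fun keep :: "bool \<Rightarrow> bool \<Rightarrow> cell \<Rightarrow> cell" where
  "keep l r N_N = N_N"
| "keep l r S_N = (if l then S_N else N_N)"
| "keep l r N_S = (if r then N_S else N_N)"
| "keep l r S_S = (if l then (if r then S_S else S_N) else (if r then N_S else N_N))"
| "keep l r R_N = (if l then R_N else N_N)"
| "keep l r N_L = (if r then N_L else N_N)"
| "keep l r RL_Z = (if l then (if r then RL_Z else R_N) else (if r then N_L else N_N))"
| "keep l r RL_S = (if l then (if r then RL_S else R_N) else (if r then N_L else N_N))"

definition normalize_gen :: "generation \<Rightarrow> generation" where
  "normalize_gen \<delta> = (\<lambda>j. \<delta> (j + Min {i. \<delta> i \<noteq> N_N}))"

text \<open>A strand is among the first (last) \<open>k\<close> iff fewer than \<open>k\<close> strands lie to its left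
  (right); within a cell, the left slot comes before the right slot.\<close>

definition first_strands :: "nat \<Rightarrow> generation \<Rightarrow> generation" where
  "first_strands k \<delta> = (\<lambda>j.
     keep (strands_in \<delta> {..<j} < k)
          (strands_in \<delta> {..<j} + of_bool (left_occupied (\<delta> j)) < k) (\<delta> j))"

definition last_strands :: "nat \<Rightarrow> generation \<Rightarrow> generation" where
  "last_strands k \<delta> = (\<lambda>j.
     keep (strands_in \<delta> {j<..} + of_bool (right_occupied (\<delta> j)) < k)
          (strands_in \<delta> {j<..} < k) (\<delta> j))"

text \<open>The subpatterns \<open>g\<^sub>k\<^sup>l\<close> and \<open>g\<^sub>k\<^sup>r\<close>; they are meaningful for non-crossing \<open>g\<close> and
  \<open>1 \<le> k \<le> n\<close> only.\<close>

definition left_subpattern :: "nat \<Rightarrow> pattern \<Rightarrow> pattern" where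
  "left_subpattern k g = smap (\<lambda>\<delta>. normalize_gen (first_strands k \<delta>)) g"

definition right_subpattern :: "nat \<Rightarrow> pattern \<Rightarrow> pattern" where
  "right_subpattern k g = smap (\<lambda>\<delta>. normalize_gen (last_strands k \<delta>)) g"


section \<open>Pure and nested gliders\<close>

definition pure_glider :: "nat \<Rightarrow> pattern \<Rightarrow> bool" where
  "pure_glider n g \<longleftrightarrow> glider n g \<and>
     (positive_speed g \<and> (\<exists>t. turning_rule_of t g \<and> \<not> t ! 1) \<or>
      negative_speed g \<and> (\<exists>t. turning_rule_of t g \<and> \<not> t ! 3))"

definition nested_glider :: "nat \<Rightarrow> pattern \<Rightarrow> bool" where
  "nested_glider n g \<longleftrightarrow> glider n g \<and> non_crossing g \<and>
     (positive_speed g \<and> (\<forall>k\<in>{1..n}. glider k (left_subpattern k g)) \<or>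
      negative_speed g \<and> (\<forall>k\<in>{1..n}. glider k (right_subpattern k g)))"

definition nested_glider_under_rule :: "nat \<Rightarrow> pattern \<Rightarrow> bool" where
  "nested_glider_under_rule n g \<longleftrightarrow> nested_glider n g \<and>
     (positive_speed g \<and>
        (\<exists>t. \<forall>k\<in>{1..n}. turning_rule_of t (left_subpattern k g)) \<or>
      negative_speed g \<and>
        (\<exists>t. \<forall>k\<in>{1..n}. turning_rule_of t (right_subpattern k g)))"

end

theory Submission
  imports Defs
begin

text \<open>Let \<open>g\<close> have positive speed, i.e.\ move to the left. Mirroring treats the other direction. A
  strand is recorded by its position and by one of four types: straight and exiting left or right
  (\<open>SL\<close>, \<open>SR\<close>), turning and exiting left or right (\<open>TL\<close>, \<open>TR\<close>). Periodicity gives all strands the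
  same displacement.

  Suppose that \<open>SE\<close> does not turn. If no strand is ever \<open>TR\<close>, then the same
  turning rule works for all \<open>g\<^sub>k\<^sup>l\<close>: deleting strands only replaces some right parents of the
  last remaining strand by an empty cell, and that strand is then the child of an \<open>SR\<close> strand,
  which does not turn. If some strand is \<open>TR\<close>, then the last such strand shows that \<open>SS\<close> turns and
  \<open>TS\<close> does not, and the first strand shows that \<open>ES\<close> turns and \<open>ET\<close> does not. Thus the first
  strand runs through words \<open>SL TL SR TR\<^sup>p\<close>. An analysis of at most three strands shows that as
  soon as \<open>p \<ge> 1\<close> occurs, it eventually occurs in every word, which contradicts the positive
  speed. Hence the first strand has the speed \<open>1/3\<close> of \<open>SL TL SR\<close>, and by comparing speeds this
  word is passed on from each strand to its right neighbour, so \<open>TR\<close> never occurs.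

  Conversely, if
  \<open>g\<^sub>1\<^sup>l\<close> is a glider, then the first strand is always \<open>TL\<close>, and so are all strands, or it repeats
  \<open>SL TL SR\<close>. In the latter case, if \<open>SE\<close> turned, every strand would need a right neighbour when
  it is \<open>SR\<close>, and this neighbour would repeat \<open>SL TL SR\<close> as well, so there would be infinitely
  many strands.\<close>

section \<open>Systems of interacting strands\<close>

datatype strand = SL | TL | SR | TR

fun strand_state :: "strand \<Rightarrow> cell_state" where
  "strand_state SL = St_S"
| "strand_state SR = St_S"
| "strand_state TL = St_T"
| "strand_state TR = St_T"

fun dir :: "strand \<Rightarrow> int" where
  "dir SL = -1"
| "dir TL = -1"
| "dir SR = 1"
| "dir TR = 1"

lemma dir_cases: "dir s = -1 \<or> dir s = 1"
  by (cases s) auto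

text \<open>Meant for strands that exit left. Such a strand is the first of its cell, so the state
  of its left parent is read off the preceding strand; neighbouring cells are at distance 2.\<close>

definition left_state :: "(nat \<Rightarrow> nat \<Rightarrow> int) \<Rightarrow> (nat \<Rightarrow> nat \<Rightarrow> strand) \<Rightarrow> nat \<Rightarrow> nat \<Rightarrow> cell_state" where
  "left_state pos ty t i =
     (if 0 < i \<and> pos t (i - 1) = pos t i - 2 then strand_state (ty t (i - 1)) else St_E)"

definition right_state ::
    "nat \<Rightarrow> (nat \<Rightarrow> nat \<Rightarrow> int) \<Rightarrow> (nat \<Rightarrow> nat \<Rightarrow> strand) \<Rightarrow> nat \<Rightarrow> nat \<Rightarrow> cell_state" where
  "right_state n pos ty t i =
     (if Suc i < n \<and> pos t (Suc i) = pos t i + 2 then strand_state (ty t (Suc i)) else St_E)"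

text \<open>A periodic non-crossing pattern in coordinates in which every strand moves by one per
  generation. Equal positions in \<open>order\<close> stand for a cell \<open>S_S\<close>;
  \<open>v\<close> is the common displacement to the left per period.\<close>

locale strand_system =
  fixes n :: nat
    and turns :: "cell_state \<Rightarrow> cell_state \<Rightarrow> bool"
    and pos :: "nat \<Rightarrow> nat \<Rightarrow> int"
    and ty :: "nat \<Rightarrow> nat \<Rightarrow> strand"
    and P :: nat
    and v :: int
  assumes pos_Suc: "i < n \<Longrightarrow> pos (Suc t) i = pos t i + dir (ty t i)"
    and ty_Suc_left: "i < n \<Longrightarrow> dir (ty t i) = -1 \<Longrightarrow>
      ty (Suc t) i = (if turns (left_state pos ty t i) (strand_state (ty t i)) then TL else SR)"
    and ty_Suc_right: "i < n \<Longrightarrow> dir (ty t i) = 1 \<Longrightarrow>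
      ty (Suc t) i = (if turns (strand_state (ty t i)) (right_state n pos ty t i) then TR else SL)"
    and order: "Suc i < n \<Longrightarrow> pos t i < pos t (Suc i) \<or>
      pos t i = pos t (Suc i) \<and> ty t i = SL \<and> ty t (Suc i) = SR"
    and parity: "Suc i < n \<Longrightarrow> even (pos t (Suc i) - pos t i)"
    and P_pos: "0 < P"
    and ty_period: "i < n \<Longrightarrow> ty (t + P) i = ty t i"
    and pos_period: "i < n \<Longrightarrow> pos (t + P) i = pos t i - v"
begin

definition gap :: "nat \<Rightarrow> nat \<Rightarrow> int" where
  "gap t i = pos t (Suc i) - pos t i"

lemma gap_Suc: "Suc i < n \<Longrightarrow> gap (Suc t) i = gap t i + dir (ty t (Suc i)) - dir (ty t i)"
  by (simp add: gap_def pos_Suc)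

lemma gap_even: "Suc i < n \<Longrightarrow> even (gap t i)"
  using parity by (simp add: gap_def)

lemma gap_cases: "Suc i < n \<Longrightarrow> 2 \<le> gap t i \<or> gap t i = 0 \<and> ty t i = SL \<and> ty t (Suc i) = SR"
proof -
  assume n: "Suc i < n"
  have "2 \<le> x" if "0 < x" "even x" for x :: int using that by presburger
  with order[OF n, of t] parity[OF n, of t] show ?thesis unfolding gap_def
    by (metis diff_gt_0_iff_gt diff_self)
qed

lemma right_neighbour: "Suc i < n \<Longrightarrow> dir (ty t i) = 1 \<Longrightarrow>
    ty (Suc t) i = (if turns (strand_state (ty t i))
      (if gap t i = 2 then strand_state (ty t (Suc i)) else St_E) then TR else SL)"
  by (simp add: ty_Suc_right right_state_def gap_def algebra_simps)

lemma left_neighbour: "Suc i < n \<Longrightarrow> dir (ty t (Suc i)) = -1 \<Longrightarrow>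
    ty (Suc t) (Suc i) = (if turns (if gap t i = 2 then strand_state (ty t i) else St_E)
      (strand_state (ty t (Suc i))) then TL else SR)"
  by (simp add: ty_Suc_left left_state_def gap_def algebra_simps)

lemma ty_right_cases: "i < n \<Longrightarrow> dir (ty t i) = 1 \<Longrightarrow> ty (Suc t) i = SL \<or> ty (Suc t) i = TR"
  by (simp add: ty_Suc_right)

lemma ty_left_cases: "i < n \<Longrightarrow> dir (ty t i) = -1 \<Longrightarrow> ty (Suc t) i = TL \<or> ty (Suc t) i = SR"
  by (simp add: ty_Suc_left)

lemma ty_left_first: "0 < n \<Longrightarrow> dir (ty t 0) = -1 \<Longrightarrow>
    ty (Suc t) 0 = (if turns St_E (strand_state (ty t 0)) then TL else SR)"
  by (simp add: ty_Suc_left left_state_def)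

section \<open>Periodic and drifting functions of time\<close>

lemma periodic_multiple:
  assumes "\<And>t. Q (t + P) = (Q t :: 'b)" shows "Q (t + m * P) = Q t"
proof (induction m)
  case (Suc m)
  have "Q (t + Suc m * P) = Q ((t + m * P) + P)" by (simp add: algebra_simps)
  then show ?case using assms Suc by simp
qed simp

lemma periodic_recur:
  assumes "\<And>t. Q (t + P) = (Q t :: 'b)" shows "\<exists>u\<ge>T. Q u = Q t"
proof -
  have "T \<le> t + T * P" using P_pos by (cases P) auto
  then show ?thesis using periodic_multiple[of Q, OF assms, of t T] by blast
qed

lemma periodic_always:
  assumes "\<And>t. Q (t + P) = Q t" and "\<And>t. t \<ge> T \<Longrightarrow> Q t" shows "Q t"
  using periodic_recur[of Q T t] assms by blast

text \<open>A nondecreasing function that returns to its value after one period cannot have risen in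
  between.\<close>

lemma periodic_mono_const:
  fixes f :: "nat \<Rightarrow> int"
  assumes per: "\<And>t. f (t + P) = f t" and mono: "\<And>t. t \<ge> T \<Longrightarrow> f t \<le> f (Suc t)" and "t \<ge> T"
  shows "f (Suc t) = f t"
proof -
  have le: "f a \<le> f b" if "T \<le> a" "a \<le> b" for a b
    using that(2,1)
  proof (induction b rule: dec_induct)
    case (step b)
    then show ?case using mono[of b] by simp
  qed simp
  have "f (Suc t) \<le> f (t + P)" using \<open>t \<ge> T\<close> P_pos by (intro le) auto
  with mono[OF \<open>t \<ge> T\<close>] per show ?thesis by (metis order_antisym)
qed

lemma invariant_from:
  assumes "I T" and "\<And>t. t \<ge> T \<Longrightarrow> I t \<Longrightarrow> I (Suc t)" and "t \<ge> T" shows "I t"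
  using assms(3) by (induction t rule: dec_induct) (use assms(1,2) in auto)

lemma drift_decreases:
  fixes f :: "nat \<Rightarrow> int"
  assumes "\<And>t. f (t + P) = f t - v" and "0 < v"
  shows "\<exists>t\<ge>T. f (Suc t) < f t"
proof (rule ccontr)
  assume neg: "\<not> ?thesis"
  have "f T \<le> f (T + m)" for m
    by (induction m) (use neg in \<open>auto simp: not_less intro: order_trans\<close>)
  from this[of P] assms show False by simp
qed

end

section \<open>Strands of a system that moves to the left\<close>

locale left_moving = strand_system +
  assumes v_pos: "0 < v"
begin

text \<open>Without \<open>TL\<close> a strand cannot make two steps to the left in succession, so
  it has no drift to the left.\<close>

lemma TL_recurs:
  assumes "i < n" shows "\<exists>t\<ge>T. ty t i = TL"
proof (rule ccontr)
  assume neg: "\<not> ?thesis"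
  \<comment> \<open>The summand 1 at \<open>SR\<close> compensates for the step to the left made
    just before.\<close>
  define h :: "strand \<Rightarrow> int" where "h s = (case s of SR \<Rightarrow> 1 | _ \<Rightarrow> 0)" for s
  have "\<exists>t\<ge>T. pos (Suc t) i + h (ty (Suc t) i) < pos t i + h (ty t i)"
    using drift_decreases[of "\<lambda>t. pos t i + h (ty t i)" T] assms v_pos
    by (simp add: pos_period ty_period)
  then obtain t where "t \<ge> T" and less: "pos (Suc t) i + h (ty (Suc t) i) < pos t i + h (ty t i)"
    by blast
  with neg have "ty t i \<noteq> TL" "ty (Suc t) i \<noteq> TL" by auto
  with less show False
    using assms ty_left_cases[OF assms, of t]
    by (cases "ty t i"; cases "ty (Suc t) i") (auto simp: pos_Suc h_def)
qed

text \<open>Every strand has displacement \<open>-v\<close> per period, so full speed forces every strand to move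
  left all the time.\<close>

lemma all_TL:
  assumes "j < n" and TL: "\<And>t. ty t j = TL" and "i < n"
  shows "ty t i = TL"
proof -
  have "pos t j = pos 0 j - int t" for t
    by (induction t) (use assms in \<open>auto simp: pos_Suc\<close>)
  from this[of P] pos_period[of j 0] assms have v: "v = int P" by simp
  have left: "dir (ty t i) = -1" for t
  proof -
    have "pos u i + int u \<le> pos (Suc u) i + int (Suc u)" for u
      using dir_cases[of "ty u i"] assms by (auto simp: pos_Suc)
    then have "pos (Suc t) i + int (Suc t) = pos t i + int t"
      using periodic_mono_const[of "\<lambda>t. pos t i + int t" 0 t] assms v by (simp add: pos_period)
    then show ?thesis using assms by (simp add: pos_Suc)
  qed
  have "ty (Suc u) i = TL" for u
    using ty_left_cases[OF \<open>i < n\<close> left[of u]] left[of "Suc u"] by auto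
  then show ?thesis
    using periodic_always[of "\<lambda>t. ty t i = TL" 1 t] assms
      by (auto simp: ty_period Suc_le_eq gr0_conv_Suc)
qed

definition cyclic :: "nat \<Rightarrow> bool" where
  "cyclic i \<longleftrightarrow> (\<forall>t. ty t i \<noteq> TR \<and> (ty t i = SL \<longrightarrow> ty (Suc t) i = TL) \<and>
     (ty t i = TL \<longrightarrow> ty (Suc t) i = SR) \<and> (ty t i = SR \<longrightarrow> ty (Suc t) i = SL))"

lemma cyclicI:
  assumes "i < n" and noTR: "\<And>t. ty t i \<noteq> TR" and "\<And>t. ty t i = SL \<Longrightarrow> ty (Suc t) i = TL"
    and "\<And>t. ty t i = TL \<Longrightarrow> ty (Suc t) i = SR"
  shows "cyclic i"
proof -
  have "ty (Suc t) i = SL" if "ty t i = SR" for t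
    using ty_right_cases[OF \<open>i < n\<close>, of t] noTR[of "Suc t"] that by simp
  with assms show ?thesis by (simp add: cyclic_def)
qed

text \<open>With the phase \<open>h\<close>, the sum \<open>3 * pos t i + int t + h (ty t i)\<close>
  is constant along the cycle; compare both ends of a period.\<close>

lemma cyclic_speed:
  assumes "i < n" "cyclic i" shows "int P = 3 * v"
proof -
  define h :: "strand \<Rightarrow> int" where "h s = (case s of SL \<Rightarrow> 0 | TL \<Rightarrow> 2 | SR \<Rightarrow> 4 | TR \<Rightarrow> 0)" for s
  have "3 * pos t i + int t + h (ty t i) = 3 * pos 0 i + h (ty 0 i)" for t
  proof (induction t)
    case (Suc t)
    then show ?case using assms by (cases "ty t i") (auto simp: pos_Suc cyclic_def h_def)
  qed simp
  from this[of P] show ?thesis using ty_period[of i 0] pos_period[of i 0] assms by simp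
qed

text \<open>A strand exiting left becomes \<open>TL\<close> or \<open>SR\<close>, so after a
  \<open>TL\<close> the first \<open>TR\<close> can only come from \<open>SR\<close>. Since
  \<open>TL\<close> recurs, periodicity covers all times.\<close>

lemma TR_start:
  assumes "i < n" "ty t i = TR" shows "\<exists>u. ty u i = SR \<and> ty (Suc u) i = TR"
proof (rule ccontr)
  assume neg: "\<not> ?thesis"
  obtain T where T: "ty T i = TL" using TL_recurs[OF \<open>i < n\<close>] by blast
  have "ty (T + m) i \<noteq> TR" for m
  proof (induction m)
    case (Suc m)
    then show ?case
      using neg ty_left_cases[OF \<open>i < n\<close>, of "T + m"] by (cases "ty (T + m) i") auto
  qed (simp add: T)
  then have "ty u i \<noteq> TR" if "u \<ge> T" for u using that le_Suc_ex by blast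
  then have "ty t i \<noteq> TR" using periodic_always[of "\<lambda>t. ty t i \<noteq> TR" T t] \<open>i < n\<close>
    by (simp add: ty_period)
  with assms show False by simp
qed

end

locale left_moving_SE = left_moving +
  assumes SE: "\<not> turns St_S St_E"
begin

text \<open>Since \<open>SE\<close> does not turn, an \<open>SR\<close> that becomes
  \<open>TR\<close> has an adjacent right neighbour. If this exited left, both would enter the same
  cell, where the left strand has to be \<open>SL\<close>.\<close>

lemma TR_startE:
  assumes "i < n" "ty t i = TR"
  obtains u where "ty u i = SR" "ty (Suc u) i = TR" "Suc i < n" "gap u i = 2" "gap (Suc u) i = 2"
    "ty u (Suc i) = SR \<and> turns St_S St_S \<or> ty u (Suc i) = TR \<and> turns St_S St_T"
    "ty (Suc u) (Suc i) \<in> {SL, TR}"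
proof -
  obtain u where u: "ty u i = SR" "ty (Suc u) i = TR" using TR_start assms by blast
  have n: "Suc i < n" and g: "gap u i = 2"
    using ty_Suc_right[of i u] u SE assms by (auto simp: right_state_def gap_def split: if_splits)
  have b: "dir (ty u (Suc i)) = 1"
  proof (rule ccontr)
    assume "dir (ty u (Suc i)) \<noteq> 1"
    then have "dir (ty u (Suc i)) = -1" by (cases "ty u (Suc i)") auto
    then have "gap (Suc u) i = 0" using gap_Suc[OF n, of u] g u by simp
    then show False using gap_cases[OF n, of "Suc u"] u by simp
  qed
  have "turns St_S (strand_state (ty u (Suc i)))"
    using right_neighbour[OF n, of u] u g by (simp split: if_splits)
  with b have "ty u (Suc i) = SR \<and> turns St_S St_S \<or> ty u (Suc i) = TR \<and> turns St_S St_T"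
    by (cases "ty u (Suc i)") auto
  moreover have "gap (Suc u) i = 2" using gap_Suc[OF n, of u] g u b by simp
  ultimately show ?thesis using that u n g ty_right_cases[OF n b] by blast
qed

end

text \<open>The bits forced by an occurrence of \<open>TR\<close>, which itself is not assumed here.
  The bits \<open>ST\<close>, \<open>TE\<close> and \<open>TT\<close> stay open.\<close>

locale entangled = left_moving_SE +
  assumes SS: "turns St_S St_S" and TS: "\<not> turns St_T St_S"
    and ES: "turns St_E St_S" and ET: "\<not> turns St_E St_T"
begin

lemma cyclic_Suc_no_TL_SL:
  assumes n: "Suc i < n" and c: "cyclic i" and t: "ty t i = TL" "ty t (Suc i) = SL" "gap t i = 2"
  shows False
proof -
  have "ty (Suc t) i = SR" using c t by (simp add: cyclic_def)
  moreover have "ty (Suc t) (Suc i) = SR" using left_neighbour[OF n, of t] t TS by simp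
  moreover have "gap (Suc t) i = 2" using gap_Suc[OF n, of t] t by simp
  \<comment> \<open>Two adjacent \<open>SR\<close> make the left one turn, which a cyclic strand
    never does.\<close>
  ultimately have "ty (Suc (Suc t)) i = TR" using right_neighbour[OF n, of "Suc t"] SS by simp
  then show False using c by (simp add: cyclic_def)
qed

text \<open>The left parent is empty or straight, because an adjacent \<open>TL\<close> has just
  been excluded and \<open>TR\<close> contradicts \<open>cyclic\<close>. Both \<open>ES\<close> and
  \<open>SS\<close> turn.\<close>

lemma cyclic_Suc_SL:
  assumes n: "Suc i < n" and c: "cyclic i" and t: "ty t (Suc i) = SL"
  shows "ty (Suc t) (Suc i) = TL"
proof (cases "gap t i = 2")
  case True
  have "ty t i \<noteq> TL" using cyclic_Suc_no_TL_SL[OF n c] t True by blast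
  moreover have "ty t i \<noteq> TR" using c by (simp add: cyclic_def)
  ultimately have "strand_state (ty t i) = St_S" by (cases "ty t i") auto
  then show ?thesis using left_neighbour[OF n, of t] True t SS by simp
next
  case False
  then show ?thesis using left_neighbour[OF n, of t] t ES by simp
qed

text \<open>Since \<open>ET\<close> does not turn, the cyclic strand is adjacent when the second
  \<open>TL\<close> arises. Of its three phases only \<open>TL\<close> is consistent.\<close>

lemma cyclic_Suc_TL_TL:
  assumes n: "Suc i < n" and c: "cyclic i"
    and t: "ty t (Suc i) = TL" "ty (Suc t) (Suc i) = TL"
  shows "ty (Suc (Suc t)) (Suc i) = SR \<and> ty (Suc (Suc (Suc t))) (Suc i) = TR"
proof -
  have g: "gap t i = 2" and b: "turns (strand_state (ty t i)) St_T"
    using left_neighbour[OF n, of t] t ET by (auto split: if_splits)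
  have c': "ty u i \<noteq> TR" "ty u i = SL \<Longrightarrow> ty (Suc u) i = TL"
    "ty u i = TL \<Longrightarrow> ty (Suc u) i = SR" "ty u i = SR \<Longrightarrow> ty (Suc u) i = SL" for u
    using c by (auto simp: cyclic_def)
  show ?thesis
  proof (cases "ty t i")
    \<comment> \<open>In this phase \<open>ST\<close> turns, as does \<open>SS\<close>, so the
      cyclic strand would become \<open>TR\<close> after its next \<open>SR\<close>.\<close>
    case SL
    have t1: "ty (Suc t) i = TL" "gap (Suc t) i = 2" using c' SL gap_Suc[OF n, of t] t g by auto
    then have t2: "ty (Suc (Suc t)) i = SR" "gap (Suc (Suc t)) i = 2"
      using c' gap_Suc[OF n, of "Suc t"] t by auto
    have "ty (Suc (Suc t)) (Suc i) = TL \<or> ty (Suc (Suc t)) (Suc i) = SR"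
      using ty_left_cases[OF n, of "Suc t"] t by simp
    then have "ty (Suc (Suc (Suc t))) i = TR"
      using right_neighbour[OF n, of "Suc (Suc t)"] t2 SS b SL by auto
    then show ?thesis using c' by simp
  next
    case SR
    then have "gap (Suc t) i = 0" using gap_Suc[OF n, of t] t g by simp
    then show ?thesis using gap_cases[OF n, of "Suc t"] t by simp
  next
    \<comment> \<open>The strands share a cell and separate. The right one then becomes
      \<open>TR\<close>, since \<open>SL\<close> next to the \<open>TL\<close> of the cyclic strand
      is excluded.\<close>
    case TL
    have t1: "ty (Suc t) i = SR" "gap (Suc t) i = 2" using c' TL gap_Suc[OF n, of t] t g by auto
    then have "gap (Suc (Suc t)) i = 0" using gap_Suc[OF n, of "Suc t"] t by simp
    then have t2: "ty (Suc (Suc t)) i = SL" "ty (Suc (Suc t)) (Suc i) = SR" "gap (Suc (Suc t)) i =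
        0"
      using gap_cases[OF n, of "Suc (Suc t)"] by auto
    have t3: "ty (Suc (Suc (Suc t))) i = TL" "gap (Suc (Suc (Suc t))) i = 2"
      using c' t2 gap_Suc[OF n, of "Suc (Suc t)"] by auto
    have "ty (Suc (Suc (Suc t))) (Suc i) \<noteq> SL" using cyclic_Suc_no_TL_SL[OF n c] t3 by blast
    then show ?thesis using ty_right_cases[OF n, of "Suc (Suc t)"] t2 by auto
  next
    case TR
    then show ?thesis using c' by simp
  qed
qed

text \<open>A word \<open>SL TL\<^sup>m SR TR\<^sup>p\<close> of the right neighbour of a cyclic strand has \<open>m = 1\<close>, or \<open>m = 2\<close>
  and \<open>p \<ge> 1\<close>. In both cases its speed is at most that of \<open>SL TL SR\<close>, with equality only for this
  word. The function \<open>G\<close> below measures how far the strand has fallen behind.\<close>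

lemma cyclic_Suc:
  assumes n: "Suc i < n" and c: "cyclic i"
  shows "cyclic (Suc i)"
proof -
  let ?b = "\<lambda>t. ty t (Suc i)"
  note SL = cyclic_Suc_SL[OF n c] and TLTL = cyclic_Suc_TL_TL[OF n c]
  \<comment> \<open>Looking back two steps, \<open>f\<close> recognises \<open>TL TL\<close>, whose
    gain is repaid by the \<open>TR\<close> that has to follow. The values make \<open>G\<close>
    constant along \<open>SL TL SR\<close> and make it grow at every step out of a
    \<open>TR\<close>.\<close>
  define f :: "nat \<Rightarrow> int" where "f t = (case ?b (Suc (Suc t)) of SL \<Rightarrow> 0 | TL \<Rightarrow> if ?b (Suc t) = TL
      then 4 else 2 |
    SR \<Rightarrow> if ?b (Suc t) = TL \<and> ?b t = TL then 6 else 4 | TR \<Rightarrow> 2)" for t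
  define G where "G t = 3 * pos (Suc (Suc t)) (Suc i) + int t + f t" for t
  have perb: "?b (t + P) = ?b t" for t using n by (simp add: ty_period)
  \<comment> \<open>Strand \<open>i\<close> gives \<open>int P = 3 * v\<close>, which makes
    \<open>G\<close> periodic.\<close>
  have perG: "G (t + P) = G t" for t
    using perb[of t] perb[of "Suc t"] perb[of "Suc (Suc t)"] pos_period[OF n, of "Suc (Suc t)"]
      cyclic_speed[of i] n c by (simp add: G_def f_def)
  have inc: "G t \<le> G (Suc t) \<and> (?b (Suc (Suc t)) = TR \<longrightarrow> G t < G (Suc t))" for t
  proof (cases "?b (Suc (Suc t))")
    case b2: SL
    then show ?thesis using SL[of "Suc (Suc t)"] n by (simp add: G_def f_def pos_Suc)
  next
    case b2: TL
    consider "?b (Suc (Suc (Suc t))) = TL" | "?b (Suc (Suc (Suc t))) = SR"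
      using ty_left_cases[OF n, of "Suc (Suc t)"] b2 by auto
    then show ?thesis using TLTL[of "Suc t"] b2 n by cases (auto simp: G_def f_def pos_Suc)
  next
    case b2: SR
    consider "?b (Suc (Suc (Suc t))) = SL" | "?b (Suc (Suc (Suc t))) = TR"
      using ty_right_cases[OF n, of "Suc (Suc t)"] b2 by auto
    then show ?thesis using TLTL[of t] b2 n by cases (auto simp: G_def f_def pos_Suc)
  next
    case b2: TR
    consider "?b (Suc (Suc (Suc t))) = SL" | "?b (Suc (Suc (Suc t))) = TR"
      using ty_right_cases[OF n, of "Suc (Suc t)"] b2 by auto
    then show ?thesis using b2 n by cases (auto simp: G_def f_def pos_Suc)
  qed
  have "G (Suc t) = G t" for t using periodic_mono_const[of G 0 t] perG inc by simp
  then have noTR2: "?b (Suc (Suc t)) \<noteq> TR" for t using inc[of t] by auto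
  have noTR: "?b t \<noteq> TR" for t
  proof (rule periodic_always[where Q = "\<lambda>t. ?b t \<noteq> TR"])
    fix t :: nat assume "2 \<le> t"
    then show "?b t \<noteq> TR" using noTR2[of "t - 2"] by (simp add: numeral_2_eq_2 Suc_diff_Suc)
  qed (simp add: perb)
  have "?b (Suc t) = SR" if "?b t = TL" for t
    using TLTL[of t] noTR ty_left_cases[OF n, of t] that by auto
  then show ?thesis using cyclicI[OF n] noTR SL by blast
qed

end


section \<open>Left-moving systems never turn right\<close>

context entangled
begin

section \<open>The first strand of an entangled system\<close>

lemma first_SL: "0 < n \<Longrightarrow> ty t 0 = SL \<Longrightarrow> ty (Suc t) 0 = TL"
  using ES by (simp add: ty_left_first)

lemma first_TL: "0 < n \<Longrightarrow> ty t 0 = TL \<Longrightarrow> ty (Suc t) 0 = SR"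
  using ET by (simp add: ty_left_first)

text \<open>The words \<open>SL TL SR TR\<^sup>p\<close> with \<open>p \<ge> 1\<close> do not move to the left.\<close>

lemma first_SR_SL:
  assumes "0 < n"
  shows "\<exists>t\<ge>T. ty t 0 = SR \<and> ty (Suc t) 0 \<noteq> TR"
proof -
  \<comment> \<open>With these weights the only step that lowers the sum is the one from
    \<open>SR\<close> to \<open>SL\<close>.\<close>
  define h :: "strand \<Rightarrow> int" where
        "h s = (case s of SL \<Rightarrow> 0 | TL \<Rightarrow> 1 | SR \<Rightarrow> 2 | TR \<Rightarrow> 1)" for s
  have "\<exists>t\<ge>T. pos (Suc t) 0 + h (ty (Suc t) 0) < pos t 0 + h (ty t 0)"
    using drift_decreases[of "\<lambda>t. pos t 0 + h (ty t 0)" T] assms v_pos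
    by (simp add: pos_period ty_period)
  then obtain t where "t \<ge> T" and less: "pos (Suc t) 0 + h (ty (Suc t) 0) < pos t 0 + h (ty t 0)"
    by blast
  then have "ty t 0 = SR \<and> ty (Suc t) 0 \<noteq> TR"
    using assms first_SL[of t] first_TL[of t] ty_right_cases[of 0 t]
    by (cases "ty t 0") (auto simp: pos_Suc h_def)
  with \<open>t \<ge> T\<close> show ?thesis by blast
qed

text \<open>The form in which the cases below are refuted: each \<open>SR\<close> of the first
  strand would be followed by \<open>TR\<close>, against \<open>first_SR_SL\<close>.\<close>

lemma first_invariant_absurd:
  assumes "0 < n" "I T" "\<And>t. t \<ge> T \<Longrightarrow> I t \<Longrightarrow> I (Suc t)"
    and "\<And>t. I t \<Longrightarrow> ty t 0 = SR \<Longrightarrow> ty (Suc t) 0 = TR"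
  shows False
  using first_SR_SL[OF \<open>0 < n\<close>, of T] invariant_from[of I T] assms by blast

text \<open>The second strand is so far away that the first one is never \<open>TR\<close> again.\<close>

definition far :: "nat \<Rightarrow> bool" where
  "far t \<longleftrightarrow> ty t 0 = SR \<and> 4 \<le> gap t 0
     \<or> ty t 0 = SL \<and> (4 \<le> gap t 0 \<or> gap t 0 = 2 \<and> (ty t 1 = TL \<or> ty t 1 = SR))
     \<or> ty t 0 = TL \<and> (4 \<le> gap t 0 \<or> gap t 0 = 2 \<and>
         (if turns St_S St_T then ty t 1 = TL else ty t 1 = SR))"

lemma far_Suc:
  assumes n: "Suc 0 < n" and bits: "turns St_S St_T \<longrightarrow> turns St_T St_T" and far: "far t"
  shows "far (Suc t)"
proof -
  note g = gap_Suc[OF n, of t] gap_cases[OF n, of "Suc t"] gap_cases[OF n, of "Suc (Suc t)"]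
    gap_even[OF n, of t]
  note l = left_neighbour[OF n, of t] right_neighbour[OF n, of t]
  have first: "ty t 0 = SL \<Longrightarrow> ty (Suc t) 0 = TL" "ty t 0 = TL \<Longrightarrow> ty (Suc t) 0 = SR"
    using first_SL first_TL n by auto
  consider (SR) "ty t 0 = SR" "4 \<le> gap t 0" | (SL) "ty t 0 = SL" "4 \<le> gap t 0"
    | (SL2) "ty t 0 = SL" "gap t 0 = 2" "ty t 1 = TL \<or> ty t 1 = SR"
    | (TL) "ty t 0 = TL" "4 \<le> gap t 0"
    | (TL2) "ty t 0 = TL" "gap t 0 = 2" "ty t 1 = SR"
    | (TL3) "ty t 0 = TL" "gap t 0 = 2" "ty t 1 = TL" "turns St_S St_T"
    using far by (auto simp: far_def split: if_splits)
  then show ?thesis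
  proof cases
    case SR
    then have "ty (Suc t) 0 = SL" using l SE by simp
    then show ?thesis using SR g ty_left_cases[OF n, of t] by (cases "ty t 1") (auto simp: far_def)
  next
    case SL
    then show ?thesis using first g by (cases "ty t 1") (auto simp: far_def)
  next
    case SL2
    then show ?thesis using first g l by (auto simp: far_def)
  next
    case TL
    then show ?thesis using first g by (cases "ty t 1") (auto simp: far_def)
  next
    case TL2
    then show ?thesis using first g by (auto simp: far_def)
  next
    \<comment> \<open>This case is contradictory: as \<open>TT\<close> turns, the second strand
      stays \<open>TL\<close> and then enters the cell of a \<open>TR\<close> strand.\<close>
    case TL3
    then have t1: "ty (Suc t) 0 = SR" "gap (Suc t) 0 = 2" "ty (Suc t) 1 = TL"
      using first g l bits by auto
    then have "ty (Suc (Suc t)) 0 = TR" using right_neighbour[OF n, of "Suc t"] TL3 by simp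
    moreover have "gap (Suc (Suc t)) 0 = 0" using gap_Suc[OF n, of "Suc t"] t1 by simp
    ultimately show ?thesis using g by simp
  qed
qed

text \<open>The states of the first two strands after a \<open>TR\<close> of the first one, as long as the second one
  does not move away.\<close>

definition bound :: "nat \<Rightarrow> bool" where
  "bound t \<longleftrightarrow> ty t 0 = TR \<and> (ty t 1 = SL \<or> ty t 1 = TR) \<and> gap t 0 = 2
     \<or> ty t 0 = SL \<and> ty t 1 = SR \<and> gap t 0 = 0
     \<or> ty t 0 = TL \<and> ty t 1 = SL \<and> gap t 0 = 2
     \<or> ty t 0 = SR \<and> ty t 1 = SR \<and> gap t 0 = 2
     \<or> \<not> turns St_T St_T \<and> gap t 0 = 2 \<and> (ty t 0 = SL \<and> ty t 1 = SL \<or> ty t 0 = TL \<and> ty t 1 = TL)"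

lemma bound_SR: "Suc 0 < n \<Longrightarrow> bound t \<Longrightarrow> ty t 0 = SR \<Longrightarrow> ty (Suc t) 0 = TR"
  using right_neighbour[of 0 t] SS by (auto simp: bound_def)

text \<open>Besides staying in \<open>bound\<close>, the second strand can move away either after
  sharing a cell with the first, or by a run of \<open>TR\<close> that outlasts that of the
  first.\<close>

lemma bound_Suc:
  assumes n: "Suc 0 < n" and b: "bound t"
  shows "bound (Suc t) \<or>
    ty t 0 = SL \<and> ty t 1 = SR \<and> gap t 0 = 0 \<and> ty (Suc t) 1 = TR \<or>
    ty t 0 = TR \<and> ty t 1 = TR \<and> gap t 0 = 2 \<and> \<not> turns St_T St_T \<and> ty (Suc t) 1 = TR"
proof -
  note g = gap_Suc[OF n, of t] gap_cases[OF n, of "Suc t"]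
  note l = left_neighbour[OF n, of t] right_neighbour[OF n, of t] ty_right_cases[OF n, of t]
  have first: "ty t 0 = SL \<Longrightarrow> ty (Suc t) 0 = TL" "ty t 0 = TL \<Longrightarrow> ty (Suc t) 0 = SR"
    using first_SL first_TL n by auto
  show ?thesis
    using b[unfolded bound_def] first g l SS TS
    by (elim disjE conjE) (auto simp: bound_def split: if_splits)
qed

lemma bound_start:
  assumes "0 < n" "ty t 0 = TR" obtains u where "Suc 0 < n" "bound u"
proof -
  obtain u where "Suc 0 < n" "ty (Suc u) 0 = TR" "gap (Suc u) 0 = 2" "ty (Suc u) (Suc 0) \<in> {SL, TR}"
    using TR_startE[OF assms] by metis
  then show ?thesis using that[of "Suc u"] by (simp add: bound_def)
qed

text \<open>Once \<open>far\<close> holds, the first strand is never \<open>TR\<close> again. By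
  periodicity, a single \<open>TR\<close> thus forces a gap of 2 at every \<open>SR\<close>. Both
  ways out of \<open>bound\<close> lead to an \<open>SR\<close> with a gap of at least 4, so
  \<open>bound\<close> persists, which is absurd.\<close>

lemma first_no_TR_tight:
  assumes bits: "turns St_S St_T \<longrightarrow> turns St_T St_T" and "0 < n"
  shows "ty t 0 \<noteq> TR"
proof
  assume TR: "ty t 0 = TR"
  then obtain T where n: "Suc 0 < n" and T: "bound T" using bound_start assms by blast
  have near: "gap u 0 = 2" if "ty u 0 = SR" for u
  proof (rule ccontr)
    assume "gap u 0 \<noteq> 2"
    moreover have "2 \<le> gap u 0" using gap_cases[OF n, of u] that by simp
    moreover have "4 \<le> x" if "x \<noteq> 2" "2 \<le> x" "even x" for x :: int using that by presburger
    ultimately have "4 \<le> gap u 0" using gap_even[OF n] by blast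
    then have u: "far u" using that by (simp add: far_def)
    have "far w" if "u \<le> w" for w by (rule invariant_from[of far, OF u _ that]) (rule far_Suc[OF n
        bits])
    then have "ty w 0 \<noteq> TR" if "u \<le> w" for w using that by (fastforce simp: far_def)
    then have "ty t 0 \<noteq> TR" using periodic_always[of "\<lambda>t. ty t 0 \<noteq> TR" u t] n
      by (simp add: ty_period)
    with TR show False by simp
  qed
  have "bound (Suc u)" if bu: "bound u" for u
  proof (rule ccontr)
    assume "\<not> bound (Suc u)"
    then consider
      (meet) "ty u 0 = SL" "ty u 1 = SR" "gap u 0 = 0" "ty (Suc u) 1 = TR"
      | (run) "ty u 0 = TR" "ty u 1 = TR" "gap u 0 = 2" "\<not> turns St_T St_T" "ty (Suc u) 1 = TR"
      using bound_Suc[OF n bu] by blast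
    then show False
    proof cases
      case meet
      have "ty (Suc u) 0 = TL" "ty (Suc (Suc u)) 0 = SR" using first_SL first_TL meet n by auto
      moreover from this have "gap (Suc (Suc u)) 0 = 4"
        using meet gap_Suc[OF n, of u] gap_Suc[OF n, of "Suc u"] by simp
      ultimately show False using near by simp
    next
      case run
      have t1: "ty (Suc u) 0 = SL" "gap (Suc u) 0 = 2"
        using right_neighbour[OF n, of u] gap_Suc[OF n, of u] run by auto
      then have t2: "ty (Suc (Suc u)) 0 = TL" "gap (Suc (Suc u)) 0 = 4"
        using first_SL gap_Suc[OF n, of "Suc u"] run n by auto
      have "ty (Suc (Suc u)) 1 = SL \<or> ty (Suc (Suc u)) 1 = TR"
        using ty_right_cases[OF n, of "Suc u"] run by simp
      then have "ty (Suc (Suc (Suc u))) 0 = SR" "4 \<le> gap (Suc (Suc (Suc u))) 0"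
        using first_TL gap_Suc[OF n, of "Suc (Suc u)"] t2 n by auto
      then show False using near by simp
    qed
  qed
  then show False using first_invariant_absurd[of bound T] T n bound_SR[OF n] by simp
qed

text \<open>A \<open>TR\<close> that comes from \<open>SR\<close> does so next to a strand that also
  exits right, so the gap stays 2. As neither \<open>TS\<close> nor \<open>TT\<close> turns, it
  lasts one step, and the next \<open>TR\<close> again comes from \<open>SR\<close>. The invariant
  \<open>W\<close> expresses this.\<close>

lemma single_TR:
  assumes TT: "\<not> turns St_T St_T" and i: "i < n" and TR: "ty t i = TR"
  shows "Suc i < n \<and> gap t i = 2 \<and> (ty t (Suc i) = SL \<or> ty t (Suc i) = TR) \<and> ty (Suc t) i = SL"
proof -
  define W where "W t \<longleftrightarrow> (ty t i = TR \<longrightarrow>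
    Suc i < n \<and> gap t i = 2 \<and> (ty t (Suc i) = SL \<or> ty t (Suc i) = TR))" for t
  have SL: "ty (Suc t) i = SL" if "ty t i = TR" "W t" for t
    using right_neighbour[of i t] that TS TT by (auto simp: W_def)
  obtain T where T: "ty T i = TL" using TL_recurs[OF i] by blast
  have "W (Suc u)" if "W u" for u
    unfolding W_def
  proof
    assume R: "ty (Suc u) i = TR"
    then have S: "ty u i = SR" using SL[OF _ that] ty_left_cases[OF i, of u]
      by (cases "ty u i") auto
    have n: "Suc i < n" and g: "gap u i = 2"
      using ty_Suc_right[OF i, of u] R S SE by (auto simp: right_state_def gap_def split: if_splits)
    have "dir (ty u (Suc i)) = 1"
    proof (rule ccontr)
      assume "dir (ty u (Suc i)) \<noteq> 1"
      then have "gap (Suc u) i = 0" using gap_Suc[OF n, of u] g S by (cases "ty u (Suc i)") auto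
      then show False using gap_cases[OF n, of "Suc u"] R by simp
    qed
    then show "Suc i < n \<and> gap (Suc u) i = 2 \<and> (ty (Suc u) (Suc i) = SL \<or> ty (Suc u) (Suc i) = TR)"
      using n g S gap_Suc[OF n, of u] ty_right_cases[OF n, of u] by simp
  qed
  moreover have "W T" using T by (simp add: W_def)
  ultimately have "W u" if "u \<ge> T" for u using invariant_from[of W T u] that by blast
  moreover have "W (u + P) = W u" for u
  proof (cases "Suc i < n")
    case True
    then show ?thesis by (simp add: W_def ty_period gap_def pos_period)
  qed (simp add: W_def ty_period i)
  ultimately have "W t" using periodic_always[of W T t] by blast
  then show ?thesis using TR SL by (simp add: W_def)
qed

text \<open>The states of the first three strands after they have left \<open>bound\<close>: the third strand no
  longer comes close enough for the second one to be \<open>TR\<close> again.\<close>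

definition bound3 :: "nat \<Rightarrow> bool" where
  "bound3 t \<longleftrightarrow>
     ty t 0 = SL \<and> ty t 1 = SR \<and> gap t 0 = 0 \<and> ty t 2 \<noteq> SR \<and> gap t 1 = 4
     \<or> ty t 0 = TL \<and> ty t 1 = SL \<and> gap t 0 = 2 \<and> (ty t 2 = SR \<and> gap t 1 = 2 \<or> ty t 2 = SL
         \<and> gap t 1 = 4)
     \<or> ty t 0 = SR \<and> ty t 1 = SR \<and> gap t 0 = 2 \<and> ty t 2 \<noteq> SR \<and> gap t 1 = 4
     \<or> ty t 0 = TR \<and> ty t 1 = SL \<and> gap t 0 = 2 \<and> (ty t 2 = SR \<and> gap t 1 = 2 \<or> ty t 2 = SL
         \<and> gap t 1 = 4)"

lemma bound3_SR: "Suc 0 < n \<Longrightarrow> bound3 t \<Longrightarrow> ty t 0 = SR \<Longrightarrow> ty (Suc t) 0 = TR"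
  using right_neighbour[of 0 t] SS by (auto simp: bound3_def)

text \<open>Whenever the second strand is \<open>SR\<close>, the third is two cells away, so the
  second returns as \<open>SL\<close>. The unwanted types of the third strand are ruled out by
  \<open>no_TL\<close> and \<open>single_TR\<close>.\<close>

lemma bound3_Suc:
  assumes n: "Suc 1 < n" and ST: "turns St_S St_T" and TT: "\<not> turns St_T St_T" and b: "bound3 t"
  shows "bound3 (Suc t)"
proof -
  have n0: "Suc 0 < n" and n2: "2 < n" using n by auto
  note g = gap_Suc[OF n0, of t] gap_cases[OF n0, of "Suc t"] gap_Suc[OF n, of t] gap_cases[OF n, of
      "Suc t"]
  note l = left_neighbour[OF n0, of t] right_neighbour[OF n0, of t]
    left_neighbour[OF n, of t] right_neighbour[OF n, of t]
  note c = single_TR[OF TT n2, of t] ty_right_cases[OF n2, of t]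
  have first: "ty t 0 = SL \<Longrightarrow> ty (Suc t) 0 = TL" "ty t 0 = TL \<Longrightarrow> ty (Suc t) 0 = SR"
    using first_SL first_TL n by auto
  \<comment> \<open>the two strands would meet in a crossing, since \<open>ST\<close> turns\<close>
  have no_meet: "\<not> (ty u 1 = SR \<and> ty u 2 = TL \<and> gap u 1 = 2)" for u
  proof
    assume u: "ty u 1 = SR \<and> ty u 2 = TL \<and> gap u 1 = 2"
    then have "ty (Suc u) 1 = TR" using right_neighbour[OF n, of u] ST by (simp add: numeral_2_eq_2)
    moreover have "gap (Suc u) 1 = 0" using gap_Suc[OF n, of u] u by (simp add: numeral_2_eq_2)
    ultimately show False using gap_cases[OF n, of "Suc u"] by simp
  qed
  \<comment> \<open>One step later the second strand is \<open>SR\<close> because \<open>TS\<close>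
    does not turn, and the third is still \<open>TL\<close> because \<open>ST\<close> turns, against
    \<open>no_meet\<close>.\<close>
  have no_TL: "\<not> (ty (Suc t) 1 = SL \<and> ty (Suc t) 2 = TL \<and> gap (Suc t) 1 = 2 \<and> gap (Suc t) 0 = 2 \<and>
    (ty (Suc t) 0 = TL \<or> ty (Suc t) 0 = TR))"
  proof
    assume u: "ty (Suc t) 1 = SL \<and> ty (Suc t) 2 = TL \<and> gap (Suc t) 1 = 2 \<and> gap (Suc t) 0 = 2 \<and>
      (ty (Suc t) 0 = TL \<or> ty (Suc t) 0 = TR)"
    then have "ty (Suc (Suc t)) 1 = SR" "ty (Suc (Suc t)) 2 = TL" "gap (Suc (Suc t)) 1 = 2"
      using left_neighbour[OF n0, of "Suc t"] left_neighbour[OF n, of "Suc t"] gap_Suc[OF n, of "Suc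
          t"] TS ST
      by (auto simp: numeral_2_eq_2)
    then show False using no_meet by blast
  qed
  have [simp]: "Suc 1 = 2" "Suc (Suc 0) = 2" by auto
  show ?thesis
    using b[unfolded bound3_def]
  proof (elim disjE conjE)
    assume "ty t 0 = SL" "ty t 1 = SR" "gap t 0 = 0" "ty t 2 \<noteq> SR" "gap t 1 = 4"
    then show ?thesis using first g l c no_TL SE ES ET by (cases "ty t 2") (auto simp: bound3_def)
  next
    assume "ty t 0 = TL" "ty t 1 = SL" "gap t 0 = 2" "ty t 2 = SR" "gap t 1 = 2"
    then show ?thesis using first g l c no_TL TS by (auto simp: bound3_def)
  next
    assume "ty t 0 = TL" "ty t 1 = SL" "gap t 0 = 2" "ty t 2 = SL" "gap t 1 = 4"
    then show ?thesis using first g l c no_TL TS ES by (auto simp: bound3_def)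
  next
    assume "ty t 0 = SR" "ty t 1 = SR" "gap t 0 = 2" "ty t 2 \<noteq> SR" "gap t 1 = 4"
    then show ?thesis using first g l c no_TL SE ES ET SS
      by (cases "ty t 2") (auto simp: bound3_def)
  next
    assume "ty t 0 = TR" "ty t 1 = SL" "gap t 0 = 2" "ty t 2 = SR" "gap t 1 = 2"
    then show ?thesis using first g l c no_TL TS by (auto simp: bound3_def)
  next
    assume "ty t 0 = TR" "ty t 1 = SL" "gap t 0 = 2" "ty t 2 = SL" "gap t 1 = 4"
    then show ?thesis using first g l c no_TL TS ES by (auto simp: bound3_def)
  qed
qed

text \<open>By \<open>single_TR\<close> a third strand is adjacent when the second is
  \<open>TR\<close>. The next steps of the first two strands are forced, and all alternatives for
  the third lead to \<open>bound3\<close>.\<close>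

lemma escape:
  assumes n0: "Suc 0 < n" and ST: "turns St_S St_T" and TT: "\<not> turns St_T St_T"
    and t: "ty t 0 = SL" "ty t 1 = SR" "gap t 0 = 0" and TR: "ty (Suc t) 1 = TR"
  shows "Suc 1 < n \<and> bound3 (t + 5)"
proof -
  have t5: "t + 5 = Suc (Suc (Suc (Suc (Suc t))))" by simp
  have n: "Suc 1 < n" and c1: "gap (Suc t) 1 = 2" "ty (Suc t) 2 = SL \<or> ty (Suc t) 2 = TR"
    and b2: "ty (Suc (Suc t)) 1 = SL"
    using single_TR[OF TT _ TR] n0 by (auto simp: numeral_2_eq_2)
  then have n2: "2 < n" by simp
  have [simp]: "Suc 1 = 2" "Suc (Suc 0) = 2" by auto
  note first = first_SL first_TL
  note g0 = gap_Suc[OF n0] and g1 = gap_Suc[OF n] and l0 = left_neighbour[OF n0] and l1 =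
      left_neighbour[OF n]
    and r0 = right_neighbour[OF n0] and c = ty_right_cases[OF n2]
  have a1: "ty (Suc t) 0 = TL" "gap (Suc t) 0 = 2"
    using first t g0[of t] n by auto
  have a2: "ty (Suc (Suc t)) 0 = SR" "gap (Suc (Suc t)) 0 = 4"
    using first a1 TR g0[of "Suc t"] n by auto
  have c2: "ty (Suc (Suc t)) 2 = SR \<and> gap (Suc (Suc t)) 1 = 0
      \<or> ty (Suc (Suc t)) 2 = SL \<and> gap (Suc (Suc t)) 1 = 2"
    using c1 TR g1[of "Suc t"] gap_cases[OF n, of "Suc (Suc t)"] single_TR[OF TT n2, of "Suc t"]
      by auto
  let ?t3 = "Suc (Suc (Suc t))"
  have a3: "ty ?t3 0 = SL" "gap ?t3 0 = 2" "ty ?t3 1 = TL"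
    using r0[of "Suc (Suc t)"] l0[of "Suc (Suc t)"] g0[of "Suc (Suc t)"] a2 b2 SE ES by auto
  have c3: "gap ?t3 1 = 2" "ty ?t3 2 \<noteq> SR"
    using c2 l1[of "Suc (Suc t)"] c[of "Suc (Suc t)"] g1[of "Suc (Suc t)"] b2 SS by auto
  let ?t4 = "Suc ?t3"
  have a4: "ty ?t4 0 = TL" "gap ?t4 0 = 2" "ty ?t4 1 = TL"
    using first l0[of ?t3] g0[of ?t3] a3 ST n by auto
  have c4: "ty ?t4 2 = SR \<and> gap ?t4 1 = 2 \<or> ty ?t4 2 = SL \<and> gap ?t4 1 = 4"
    using c3 l1[of ?t3] g1[of ?t3] a3 TS TT single_TR[OF TT n2, of ?t3] by (cases "ty ?t3 2") auto
  have a5: "ty (Suc ?t4) 0 = SR" "gap (Suc ?t4) 0 = 2" "ty (Suc ?t4) 1 = SR"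
    using first l0[of ?t4] g0[of ?t4] a4 TT n by auto
  have c5: "ty (Suc ?t4) 2 \<noteq> SR" "gap (Suc ?t4) 1 = 4"
    using c4 l1[of ?t4] c[of ?t4] g1[of ?t4] a4 ES by auto
  have "bound3 (Suc ?t4)" using a5 c5 by (simp add: bound3_def)
  then show ?thesis unfolding t5 using n by simp
qed

lemma first_no_TR_loose:
  assumes ST: "turns St_S St_T" and TT: "\<not> turns St_T St_T" and "0 < n"
  shows "ty t 0 \<noteq> TR"
proof
  assume "ty t 0 = TR"
  then obtain T where n: "Suc 0 < n" and T: "bound T" using bound_start assms by blast
  \<comment> \<open>A run of two \<open>TR\<close> of the second strand is excluded by
    \<open>single_TR\<close>; the other way out of \<open>bound\<close> is covered by
    \<open>escape\<close>.\<close>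
  have step: "bound (Suc u) \<or> Suc 1 < n \<and> bound3 (u + 5)" if "bound u" for u
    using bound_Suc[OF n that] escape[OF n ST TT, of u] single_TR[OF TT, of 1 u] n by auto
  show False
  proof (cases "Suc 1 < n \<and> (\<exists>u. bound3 u)")
    case True
    then obtain u where "Suc 1 < n" "bound3 u" by blast
    then show False
      using first_invariant_absurd[of bound3 u] bound3_Suc[OF _ ST TT] bound3_SR[OF n] n by simp
  next
    case False
    then show False using first_invariant_absurd[of bound T] T n bound_SR[OF n] step by auto
  qed
qed

text \<open>The two preceding lemmas on the first strand cover all values of \<open>ST\<close> and
  \<open>TT\<close>. Without \<open>TR\<close> this strand is cyclic, and \<open>cyclic_Suc\<close>
  passes this on to the right.\<close>

lemma no_TR:
  assumes "i < n" shows "ty t i \<noteq> TR"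
proof -
  have "ty t 0 \<noteq> TR" for t
    using first_no_TR_tight[of t] first_no_TR_loose[of t] assms by linarith
  then have "cyclic 0"
    using first_SL first_TL assms by (intro cyclicI) auto
  then have "cyclic i"
    using assms by (induction i) (auto intro: cyclic_Suc)
  then show ?thesis by (simp add: cyclic_def)
qed

end

context left_moving_SE
begin

theorem no_TR:
  assumes "i < n" shows "ty t i \<noteq> TR"
proof
  assume "ty t i = TR"
  \<comment> \<open>The last strand that is ever \<open>TR\<close>; its right neighbour never is,
    which determines \<open>SS\<close> and \<open>TS\<close>.\<close>
  define k where "k = Max {k. k < n \<and> (\<exists>t. ty t k = TR)}"
  have fin: "finite {k. k < n \<and> (\<exists>t. ty t k = TR)}" by simp
  have "k \<in> {k. k < n \<and> (\<exists>t. ty t k = TR)}"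
    unfolding k_def using assms \<open>ty t i = TR\<close> by (intro Max_in fin) auto
  then obtain s where k: "k < n" "ty s k = TR" by blast
  have max: "ty u j \<noteq> TR" if "k < j" "j < n" for j u
    using Max_ge[OF fin, of j] that unfolding k_def[symmetric] by auto
  obtain u where u: "Suc k < n" "ty u k = SR" "ty (Suc u) k = TR" "gap u k = 2" "gap (Suc u) k = 2"
    "ty u (Suc k) = SR \<and> turns St_S St_S \<or> ty u (Suc k) = TR \<and> turns St_S St_T"
    "ty (Suc u) (Suc k) \<in> {SL, TR}"
    using TR_startE[OF k] by blast
  have SS: "turns St_S St_S" and b: "ty (Suc u) (Suc k) = SL" using u max by auto
  \<comment> \<open>Both strands enter the same cell, where the left one must be \<open>SL\<close>;
    so \<open>TS\<close> does not turn.\<close>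
  have "gap (Suc (Suc u)) k = 0" using gap_Suc[OF \<open>Suc k < n\<close>, of "Suc u"] u b by simp
  then have "ty (Suc (Suc u)) k = SL" using gap_cases[OF \<open>Suc k < n\<close>, of "Suc (Suc u)"] by simp
  then have TS: "\<not> turns St_T St_S"
    using right_neighbour[OF \<open>Suc k < n\<close>, of "Suc u"] u b by auto
  have n: "0 < n" using assms by simp
  obtain w where w: "ty w 0 = TL" using TL_recurs[OF n] by blast
  \<comment> \<open>Otherwise a \<open>TL\<close> of the first strand would persist, and full speed
    would make all strands \<open>TL\<close>.\<close>
  have ET: "\<not> turns St_E St_T"
  proof
    assume "turns St_E St_T"
    then have step: "ty (Suc w) 0 = TL" if "ty w 0 = TL" for w
      using ty_left_first[OF n, of w] that by simp
    have "ty x 0 = TL" if "w \<le> x" for x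
      by (rule invariant_from[of "\<lambda>x. ty x 0 = TL", OF w _ that]) (rule step)
    then have "ty x 0 = TL" for x
      using periodic_always[of "\<lambda>x. ty x 0 = TL" w x] n by (simp add: ty_period)
    then show False using all_TL[of 0 k] k n by simp
  qed
  have ES: "turns St_E St_S"
  proof (rule ccontr)
    assume "\<not> turns St_E St_S"
    with ET have "ty (Suc x) 0 \<noteq> TL" for x
      using ty_left_first[OF n, of x] ty_right_cases[OF n, of x] by (cases "ty x 0") auto
    then show False using TL_recurs[OF n, of 1] by (metis Suc_le_D One_nat_def)
  qed
  interpret entangled n turns pos ty P v by unfold_locales (fact SS TS ES ET)+
  show False using no_TR[OF k(1)] k(2) by blast
qed

end

section \<open>Lone strands, and cyclic strands when \<open>SE\<close> turns\<close>

context left_moving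
begin

text \<open>The other parent is always empty. If \<open>ET\<close> turns, then \<open>TL\<close>
  persists. Otherwise \<open>TL\<close> recurs only if \<open>ES\<close> turns, and the drift to the
  left excludes that \<open>SE\<close> turns.\<close>

lemma single_strand:
  assumes "n = 1" shows "(\<forall>t. ty t 0 = TL) \<or> cyclic 0"
proof -
  have n: "0 < n" using assms by simp
  have r: "ty (Suc t) 0 = (if turns (strand_state (ty t 0)) St_E then TR else SL)" if "dir (ty t 0)
      = 1" for t
    using ty_Suc_right[OF n, of t] that assms by (simp add: right_state_def)
  note l = ty_left_first[OF n]
  obtain w where w: "ty w 0 = TL" using TL_recurs[OF n] by blast
  show ?thesis
  proof (cases "turns St_E St_T")
    case True
    then have step: "ty (Suc w) 0 = TL" if "ty w 0 = TL" for w using l[of w] that by simp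
    have "ty x 0 = TL" if "w \<le> x" for x
      by (rule invariant_from[of "\<lambda>x. ty x 0 = TL", OF w _ that]) (rule step)
    then have "ty x 0 = TL" for x
      using periodic_always[of "\<lambda>x. ty x 0 = TL" w x] n by (simp add: ty_period)
    then show ?thesis by simp
  next
    case ET: False
    have ES: "turns St_E St_S"
    proof (rule ccontr)
      assume "\<not> turns St_E St_S"
      with ET have "ty (Suc x) 0 \<noteq> TL" for x
        using l[of x] ty_right_cases[OF n, of x] by (cases "ty x 0") auto
      then show False using TL_recurs[OF n, of 1] by (metis Suc_le_D One_nat_def)
    qed
    have SE: "\<not> turns St_S St_E"
    proof
      assume SE: "turns St_S St_E"
      define h :: "strand \<Rightarrow> int" where
        "h s = (case s of SL \<Rightarrow> 0 | TL \<Rightarrow> 1 | SR \<Rightarrow> 2 | TR \<Rightarrow> 1)" for s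
      obtain t where "pos (Suc t) 0 + h (ty (Suc t) 0) < pos t 0 + h (ty t 0)"
        using drift_decreases[of "\<lambda>t. pos t 0 + h (ty t 0)" 0] n v_pos
        by (auto simp: pos_period ty_period)
      then show False
        using l[of t] r[of t] ES ET SE n
        by (cases "ty t 0") (auto simp: pos_Suc h_def split: if_splits)
    qed
    interpret left_moving_SE n turns pos ty P v by unfold_locales (fact SE)
    have "cyclic 0" using no_TR[OF n] l ES ET n by (intro cyclicI) auto
    then show ?thesis by simp
  qed
qed

text \<open>If \<open>SE\<close> turns, then a cyclic strand needs a right neighbour whenever it is \<open>SR\<close>, and the
  phases of this neighbour are determined.\<close>

lemma cyclic_SE_Suc:
  assumes SE: "turns St_S St_E" and i: "i < n" and c: "cyclic i"
  shows "Suc i < n \<and> cyclic (Suc i)"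
proof -
  have c': "ty u i \<noteq> TR" "ty u i = SL \<Longrightarrow> ty (Suc u) i = TL"
    "ty u i = TL \<Longrightarrow> ty (Suc u) i = SR" "ty u i = SR \<Longrightarrow> ty (Suc u) i = SL" for u
    using c by (auto simp: cyclic_def)
  obtain w where "ty w i = TL" using TL_recurs[OF i] by blast
  then have w: "ty (Suc w) i = SR" using c' by simp
  \<comment> \<open>\<open>SR\<close> returns as \<open>SL\<close> although \<open>SE\<close> turns,
    so its right parent is not empty.\<close>
  have near: "Suc i < n \<and> pos t (Suc i) = pos t i + 2" if "ty t i = SR" for t
    using ty_Suc_right[OF i, of t] c'(4)[OF that] that SE
      by (auto simp: right_state_def split: if_splits)
  then have n: "Suc i < n" using w by blast
  have g: "gap t i = 2" if "ty t i = SR" for t using near[OF that] by (simp add: gap_def)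
  let ?b = "\<lambda>t. ty t (Suc i)"
  note gs = gap_Suc[OF n]
  have word: "?b t = TL \<and> ?b (Suc t) = SR \<and> ?b (Suc (Suc t)) = SL"
    if t: "ty t i = SR" and slot: "?b t = TL \<or> ?b t = SR" for t
  proof -
    have a: "ty (Suc t) i = SL" "ty (Suc (Suc t)) i = TL" "ty (Suc (Suc (Suc t))) i = SR"
      using c' t by auto
    have g0: "gap t i = 2" and g3: "gap (Suc (Suc (Suc t))) i = 2" using g t a by auto
    \<comment> \<open>Adjacency at the next \<open>SR\<close> of the cyclic strand forces its
      neighbour to be adjacent and to exit left one step earlier.\<close>
    have g2: "gap (Suc (Suc t)) i = 2" "dir (?b (Suc (Suc t))) = -1"
      using gs[of "Suc (Suc t)"] g3 a gap_cases[OF n, of "Suc (Suc t)"]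
      by (cases "?b (Suc (Suc t))"; simp)+
    show ?thesis
    proof (cases "?b t = TL")
      case True
      then have "gap (Suc t) i = 0" using gs[of t] t g0 by simp
      then have "?b (Suc t) = SR" using gap_cases[OF n, of "Suc t"] by simp
      moreover have "?b (Suc (Suc t)) = SL"
        using ty_right_cases[OF n, of "Suc t"] \<open>?b (Suc t) = SR\<close> g2 by auto
      ultimately show ?thesis using True by simp
    next
      \<comment> \<open>Two adjacent \<open>SR\<close> show that \<open>SS\<close> does not turn, so
        the neighbour becomes \<open>SR\<close> just when it has to exit left.\<close>
      case False
      then have b: "?b t = SR" using slot by simp
      have g1: "gap (Suc t) i = 2" using gs[of t] t g0 b by simp
      have "dir (?b (Suc t)) = -1" using gs[of "Suc t"] a g1 g2 by (cases "?b (Suc t)") auto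
      then have b1: "?b (Suc t) = SL" using ty_right_cases[OF n, of t] b by auto
      have "\<not> turns St_S St_S" using right_neighbour[OF n, of t] t a g0 b by auto
      then have "?b (Suc (Suc t)) = SR" using left_neighbour[OF n, of "Suc t"] a b1 g1 by simp
      then show ?thesis using g2 by simp
    qed
  qed
  have slot: "?b (Suc t) = TL \<or> ?b (Suc t) = SR" if "ty t i = TL" for t
  proof -
    have "ty (Suc t) i = SR" using c' that by simp
    then have "gap (Suc t) i = 2" using g by simp
    then have "dir (?b t) = -1"
      using gs[of t] that gap_cases[OF n, of t] by (cases "?b t") auto
    then show ?thesis using ty_left_cases[OF n] by blast
  qed
  \<comment> \<open>Within three steps strand \<open>i\<close> has passed through \<open>TL\<close>,
    which fixes the phase of its neighbour.\<close>
  have ev: "?b t \<noteq> TR \<and> (?b t = SL \<longrightarrow> ?b (Suc t) = TL) \<and> (?b t = TL \<longrightarrow> ?b (Suc t) = SR)"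
    if "t \<ge> 3" for t
  proof -
    define s where "s = t - 3"
    have s: "t = Suc (Suc (Suc s))" using that by (simp add: s_def)
    have word': "?b (Suc u) = TL \<and> ?b (Suc (Suc u)) = SR \<and> ?b (Suc (Suc (Suc u))) = SL"
      if "ty u i = TL" for u
      using word[of "Suc u"] slot[OF that] c'(3)[OF that] by simp
    show ?thesis
    proof (cases "ty s i")
      case SL
      then show ?thesis using word'[of "Suc s"] c' s by simp
    next
      case SR
      then show ?thesis using word'[of "Suc (Suc s)"] c' s by simp
    next
      case TL
      then show ?thesis using word'[of s] word'[of "Suc (Suc (Suc s))"] c' s by simp
    next
      case TR
      then show ?thesis using c' by simp
    qed
  qed
  have "?b t \<noteq> TR \<and> (?b t = SL \<longrightarrow> ?b (Suc t) = TL) \<and> (?b t = TL \<longrightarrow> ?b (Suc t) = SR)" for t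
  proof (rule periodic_always[where T = 3 and Q = "\<lambda>t. ?b t \<noteq> TR \<and> (?b t = SL \<longrightarrow> ?b (Suc t) = TL) \<and>
      (?b t = TL \<longrightarrow> ?b (Suc t) = SR)"])
    fix t
    show "(?b (t + P) \<noteq> TR \<and> (?b (t + P) = SL \<longrightarrow> ?b (Suc (t + P)) = TL) \<and>
        (?b (t + P) = TL \<longrightarrow> ?b (Suc (t + P)) = SR)) =
      (?b t \<noteq> TR \<and> (?b t = SL \<longrightarrow> ?b (Suc t) = TL) \<and> (?b t = TL \<longrightarrow> ?b (Suc t) = SR))"
      using ty_period[OF n, of t] ty_period[OF n, of "Suc t"] by simp
  qed (rule ev)
  then show ?thesis using cyclicI[OF n] n by blast
qed

lemma cyclic_not_SE:
  assumes "cyclic 0" "0 < n" shows "\<not> turns St_S St_E"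
proof
  assume SE: "turns St_S St_E"
  have "i < n \<and> cyclic i" for i
    by (induction i) (use assms cyclic_SE_Suc[OF SE] in auto)
  then show False by blast
qed

end


section \<open>Strands of a sequence of generations\<close>

definition mirror_strand :: "strand \<Rightarrow> strand" where
  "mirror_strand s = (case s of SL \<Rightarrow> SR | TL \<Rightarrow> TR | SR \<Rightarrow> SL | TR \<Rightarrow> TL)"

lemma mirror_strand_simps [simp]:
  "dir (mirror_strand s) = - dir s" "strand_state (mirror_strand s) = strand_state s"
  by (cases s; simp add: mirror_strand_def)+

lemma mirror_strand_eq [simp]:
  "mirror_strand s = SL \<longleftrightarrow> s = SR" "mirror_strand s = SR \<longleftrightarrow> s = SL"
  "mirror_strand s = TL \<longleftrightarrow> s = TR" "mirror_strand s = TR \<longleftrightarrow> s = TL"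
  by (cases s; simp add: mirror_strand_def)+

text \<open>Carries results on motion to the left over to motion to the right. Indices are reversed
  because strands are numbered from the left.\<close>

lemma (in strand_system) mirror:
  "strand_system n (\<lambda>A B. turns B A) (\<lambda>t i. - pos t (n - Suc i))
     (\<lambda>t i. mirror_strand (ty t (n - Suc i))) P (- v)"
proof
  fix t i assume i: "i < n"
  let ?j = "n - Suc i"
  have j: "?j < n" using i by simp
  have l: "left_state (\<lambda>t i. - pos t (n - Suc i)) (\<lambda>t i. mirror_strand (ty t (n - Suc i))) t i
      = right_state n pos ty t ?j"
    using i by (auto simp: left_state_def right_state_def Suc_diff_Suc)
  have r: "right_state n (\<lambda>t i. - pos t (n - Suc i)) (\<lambda>t i. mirror_strand (ty t (n - Suc i))) t i
      = left_state pos ty t ?j"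
    using i by (auto simp: left_state_def right_state_def)
  show "- pos (Suc t) ?j = - pos t ?j + dir (mirror_strand (ty t ?j))"
    using pos_Suc[OF j] by simp
  show "mirror_strand (ty (t + P) ?j) = mirror_strand (ty t ?j)" using ty_period[OF j] by simp
  show "- pos (t + P) ?j = - pos t ?j - - v" using pos_period[OF j] by simp
  show "mirror_strand (ty (Suc t) ?j) = (if turns (strand_state (mirror_strand (ty t ?j)))
      (left_state (\<lambda>t i. - pos t (n - Suc i)) (\<lambda>t i. mirror_strand (ty t (n - Suc i))) t i) then TL
          else SR)"
    if "dir (mirror_strand (ty t ?j)) = -1"
    using ty_Suc_right[OF j, of t] that unfolding l by simp
  show "mirror_strand (ty (Suc t) ?j) =
      (if turns (right_state n (\<lambda>t i. - pos t (n - Suc i)) (\<lambda>t i. mirror_strand (ty t (n - Suc i)))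
          t i)
        (strand_state (mirror_strand (ty t ?j))) then TR else SL)"
    if "dir (mirror_strand (ty t ?j)) = 1"
    using ty_Suc_left[OF j, of t] that unfolding r by simp
next
  fix t i assume i: "Suc i < n"
  have j: "n - Suc i = Suc (n - Suc (Suc i))" using i by simp
  show "- pos t (n - Suc i) < - pos t (n - Suc (Suc i)) \<or>
    - pos t (n - Suc i) = - pos t (n - Suc (Suc i)) \<and> mirror_strand (ty t (n - Suc i)) = SL \<and>
    mirror_strand (ty t (n - Suc (Suc i))) = SR"
    using order[of "n - Suc (Suc i)" t] i unfolding j by auto
  show "even (- pos t (n - Suc (Suc i)) - - pos t (n - Suc i))"
    using parity[of "n - Suc (Suc i)" t] i unfolding j by simp
qed (rule P_pos)

section \<open>Ranks in finite linearly ordered sets\<close>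

lemma sorted_list_of_set_image_strict_mono:
  fixes f :: "'a::linorder \<Rightarrow> 'b::linorder"
  assumes "finite A" "strict_mono_on A f"
  shows "sorted_list_of_set (f ` A) = map f (sorted_list_of_set A)"
proof -
  have "sorted_wrt (\<lambda>x y. f x < f y) (sorted_list_of_set A)"
    by (rule sorted_wrt_mono_rel[OF _ strict_sorted_list_of_set])
      (use assms in \<open>auto simp: strict_mono_on_def\<close>)
  then show ?thesis
    using assms by (intro strict_sorted_equal) (auto simp: sorted_wrt_map)
qed

lemma card_less_nth_sorted_list_of_set:
  fixes A :: "'a::linorder set"
  assumes "finite A" "i < card A"
  shows "card {y \<in> A. y < sorted_list_of_set A ! i} = i"
proof -
  let ?l = "sorted_list_of_set A"
  have mono: "?l ! j < ?l ! k \<longleftrightarrow> j < k" if "j < card A" "k < card A" for j k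
    using that strict_sorted_list_of_set[of A]
    by (metis length_sorted_list_of_set linorder_neqE_nat order_less_asym sorted_wrt_nth_less
        order_less_irrefl)
  have "{y \<in> A. y < ?l ! i} = (\<lambda>j. ?l ! j) ` {..<i}"
  proof (intro set_eqI iffI)
    fix y assume y: "y \<in> {y \<in> A. y < ?l ! i}"
    then obtain j where "j < card A" "y = ?l ! j"
      using assms by (metis (no_types, lifting) in_set_conv_nth length_sorted_list_of_set
          mem_Collect_eq set_sorted_list_of_set)
    then show "y \<in> (\<lambda>j. ?l ! j) ` {..<i}" using y mono assms by auto
  next
    fix y assume "y \<in> (\<lambda>j. ?l ! j) ` {..<i}"
    then obtain j where "j < i" "y = ?l ! j" by auto
    then show "y \<in> {y \<in> A. y < ?l ! i}"
      using mono assms by (metis (no_types, lifting) in_set_conv_nth length_sorted_list_of_set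
          mem_Collect_eq
        order_less_trans set_sorted_list_of_set)
  qed
  moreover have "inj_on (\<lambda>j. ?l ! j) {..<i}"
    using mono assms by (intro inj_onI) (metis lessThan_iff linorder_neqE_nat order_less_irrefl
        order_less_trans)
  ultimately show ?thesis by (simp add: card_image)
qed

section \<open>Slots of non-crossing generations\<close>

lemma cell_cases_noncrossing: "\<not> is_crossing c \<longleftrightarrow> c \<in> {N_N, S_N, N_S, S_S, R_N, N_L}"
  by (cases c) (auto simp: is_crossing_def)

lemmas cell_defs = left_occupied_def right_occupied_def exits_left_def exits_right_def
    is_crossing_def

text \<open>Keys number the slots from left to right: the left and the right slot of cell \<open>j\<close> have the
  keys \<open>2 * j\<close> and \<open>2 * j + 1\<close>.\<close>

definition keys :: "generation \<Rightarrow> int set" where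
  "keys \<delta> = {\<kappa>. if even \<kappa> then left_occupied (\<delta> (\<kappa> div 2)) else right_occupied (\<delta> (\<kappa> div 2))}"

text \<open>Without crossings a turning strand is alone in its cell, so comparison with
  \<open>R_N\<close> or \<open>N_L\<close> decides whether it turns.\<close>

definition strand_of :: "generation \<Rightarrow> int \<Rightarrow> strand" where
  "strand_of \<delta> \<kappa> =
     (if even \<kappa> then if \<delta> (\<kappa> div 2) = R_N then TR else SL
      else if \<delta> (\<kappa> div 2) = N_L then TL else SR)"

text \<open>A strand of cell \<open>j\<close> exiting right enters the left slot of cell
  \<open>j + e\<close>. One exiting left enters the right slot of cell \<open>j + e - 1\<close>,
  whose key is \<open>2 * (j + e) - 1\<close>.\<close>

definition next_key :: "int \<Rightarrow> generation \<Rightarrow> int \<Rightarrow> int" where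
  "next_key e \<delta> \<kappa> = 2 * (\<kappa> div 2 + e) - of_bool (dir (strand_of \<delta> \<kappa>) = -1)"

lemma keys_simps [simp]:
  "2 * j \<in> keys \<delta> \<longleftrightarrow> left_occupied (\<delta> j)" "2 * j + 1 \<in> keys \<delta> \<longleftrightarrow> right_occupied (\<delta> j)"
  by (auto simp: keys_def)

lemma key_cases: obtains (left) j :: int where "\<kappa> = 2 * j" | (right) j where "\<kappa> = 2 * j + 1"
  by (metis evenE oddE)

lemma keysE:
  assumes "\<kappa> \<in> keys \<delta>"
  obtains (left) j where "\<kappa> = 2 * j" "left_occupied (\<delta> j)"
    | (right) j where "\<kappa> = 2 * j + 1" "right_occupied (\<delta> j)"
  using assms by (cases \<kappa> rule: key_cases) auto

lemma strand_of_simps [simp]: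
  "strand_of \<delta> (2 * j) = (if \<delta> j = R_N then TR else SL)"
  "strand_of \<delta> (2 * j + 1) = (if \<delta> j = N_L then TL else SR)"
  by (auto simp: strand_of_def)

lemma next_key_simps [simp]:
  "next_key e \<delta> (2 * j) = (if \<delta> j = R_N then 2 * (j + e) else 2 * (j + e) - 1)"
  "next_key e \<delta> (2 * j + 1) = (if \<delta> j = N_L then 2 * (j + e) - 1 else 2 * (j + e))"
  by (auto simp: next_key_def)

lemma next_key_div:
  "next_key e \<delta> \<kappa> div 2 = \<kappa> div 2 + e - of_bool (dir (strand_of \<delta> \<kappa>) = -1)"
  unfolding next_key_def by (cases "dir (strand_of \<delta> \<kappa>) = -1") simp_all

lemma nonempty_iff_keys: "\<delta> j \<noteq> N_N \<longleftrightarrow> 2 * j \<in> keys \<delta> \<or> 2 * j + 1 \<in> keys \<delta>"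
  by (cases "\<delta> j") (auto simp: cell_defs)

lemma noncrossing_cases:
  assumes "\<not> is_crossing c"
  obtains "c = N_N" | "c = S_N" | "c = N_S" | "c = S_S" | "c = R_N" | "c = N_L"
  using assms unfolding cell_cases_noncrossing by blast

lemma exits_right_iff:
  assumes "\<not> is_crossing (\<delta> j)"
  shows "exits_right (\<delta> j) \<longleftrightarrow> (\<exists>\<kappa>\<in>keys \<delta>. \<kappa> div 2 = j \<and> dir (strand_of \<delta> \<kappa>) = 1)"
proof
  assume "exits_right (\<delta> j)"
  then have "2 * j \<in> keys \<delta> \<and> \<delta> j = R_N \<or> 2 * j + 1 \<in> keys \<delta> \<and> \<delta> j \<noteq> N_L"
    by (cases rule: noncrossing_cases[OF assms]) (auto simp: cell_defs)
  then show "\<exists>\<kappa>\<in>keys \<delta>. \<kappa> div 2 = j \<and> dir (strand_of \<delta> \<kappa>) = 1"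
  proof
    assume "2 * j \<in> keys \<delta> \<and> \<delta> j = R_N"
    then show ?thesis by (intro bexI[of _ "2 * j"]) auto
  next
    assume "2 * j + 1 \<in> keys \<delta> \<and> \<delta> j \<noteq> N_L"
    then show ?thesis by (intro bexI[of _ "2 * j + 1"]) auto
  qed
next
  assume "\<exists>\<kappa>\<in>keys \<delta>. \<kappa> div 2 = j \<and> dir (strand_of \<delta> \<kappa>) = 1"
  then obtain \<kappa> where "\<kappa> \<in> keys \<delta>" "\<kappa> div 2 = j" "dir (strand_of \<delta> \<kappa>) = 1" by blast
  then show "exits_right (\<delta> j)"
    by (cases rule: keysE; cases rule: noncrossing_cases[OF assms]) (auto simp: cell_defs split:
        if_splits)
qed

lemma exits_left_iff:
  assumes "\<not> is_crossing (\<delta> j)"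
  shows "exits_left (\<delta> j) \<longleftrightarrow> (\<exists>\<kappa>\<in>keys \<delta>. \<kappa> div 2 = j \<and> dir (strand_of \<delta> \<kappa>) = -1)"
proof
  assume "exits_left (\<delta> j)"
  then have "2 * j \<in> keys \<delta> \<and> \<delta> j \<noteq> R_N \<or> 2 * j + 1 \<in> keys \<delta> \<and> \<delta> j = N_L"
    by (cases rule: noncrossing_cases[OF assms]) (auto simp: cell_defs)
  then show "\<exists>\<kappa>\<in>keys \<delta>. \<kappa> div 2 = j \<and> dir (strand_of \<delta> \<kappa>) = -1"
  proof
    assume "2 * j \<in> keys \<delta> \<and> \<delta> j \<noteq> R_N"
    then show ?thesis by (intro bexI[of _ "2 * j"]) auto
  next
    assume "2 * j + 1 \<in> keys \<delta> \<and> \<delta> j = N_L"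
    then show ?thesis by (intro bexI[of _ "2 * j + 1"]) auto
  qed
next
  assume "\<exists>\<kappa>\<in>keys \<delta>. \<kappa> div 2 = j \<and> dir (strand_of \<delta> \<kappa>) = -1"
  then obtain \<kappa> where "\<kappa> \<in> keys \<delta>" "\<kappa> div 2 = j" "dir (strand_of \<delta> \<kappa>) = -1" by blast
  then show "exits_left (\<delta> j)"
    by (cases rule: keysE; cases rule: noncrossing_cases[OF assms]) (auto simp: cell_defs split:
        if_splits)
qed

lemma nonempty_key: "\<delta> j \<noteq> N_N \<Longrightarrow> \<exists>\<kappa>\<in>keys \<delta>. \<kappa> div 2 = j"
  unfolding nonempty_iff_keys by (elim disjE bexI[rotated]) simp_all

lemma key_nonempty: "\<kappa> \<in> keys \<delta> \<Longrightarrow> \<delta> (\<kappa> div 2) \<noteq> N_N"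
  by (auto elim!: keysE simp: cell_defs)

text \<open>The generations need not start at position 0. The child of \<open>S t k\<close> and \<open>S t (k + 1)\<close> is the
  cell \<open>k + e t\<close> of the next generation, so \<open>e\<close> is the same for all subpatterns.\<close>

locale flow =
  fixes S :: "nat \<Rightarrow> generation" and e :: "nat \<Rightarrow> int" and n :: nat
  assumes cont_left: "left_occupied (S (Suc t) (k + e t)) \<longleftrightarrow> exits_right (S t k)"
    and cont_right: "right_occupied (S (Suc t) (k + e t)) \<longleftrightarrow> exits_left (S t (k + 1))"
    and not_crossing: "\<not> is_crossing (S t k)"
    and finite_keys: "finite (keys (S t))"
    and card_keys: "card (keys (S t)) = n"
begin

definition key :: "nat \<Rightarrow> nat \<Rightarrow> int" where
  "key t i = sorted_list_of_set (keys (S t)) ! i"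

definition kind :: "nat \<Rightarrow> nat \<Rightarrow> strand" where
  "kind t i = strand_of (S t) (key t i)"

text \<open>In the coordinates \<open>2 * j + off t\<close> a child lies halfway between its parents.\<close>

primrec off :: "nat \<Rightarrow> int" where
  "off 0 = 0"
| "off (Suc t) = off t + 1 - 2 * e t"

definition pos :: "nat \<Rightarrow> nat \<Rightarrow> int" where
  "pos t i = 2 * (key t i div 2) + off t"

lemma key_in: "i < n \<Longrightarrow> key t i \<in> keys (S t)"
  using finite_keys[of t] card_keys[of t] unfolding key_def
  by (metis length_sorted_list_of_set nth_mem set_sorted_list_of_set)

lemma key_surj: "\<kappa> \<in> keys (S t) \<Longrightarrow> \<exists>i<n. key t i = \<kappa>"
  using finite_keys[of t] card_keys[of t] unfolding key_def
  by (metis in_set_conv_nth length_sorted_list_of_set set_sorted_list_of_set)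

lemma key_less: "i < j \<Longrightarrow> j < n \<Longrightarrow> key t i < key t j"
  using card_keys[of t] strict_sorted_list_of_set[of "keys (S t)"] unfolding key_def
  by (metis length_sorted_list_of_set sorted_wrt_nth_less)

lemma key_less_iff: "i < n \<Longrightarrow> j < n \<Longrightarrow> key t i < key t j \<longleftrightarrow> i < j"
  using key_less by (metis linorder_neqE_nat order_less_asym order_less_irrefl)

lemma key_gap: "i < j \<Longrightarrow> j < n \<Longrightarrow> key t i < \<kappa> \<Longrightarrow> \<kappa> < key t j \<Longrightarrow> j = Suc i \<Longrightarrow> \<kappa> \<notin> keys (S t)"
  using key_surj[of \<kappa> t] key_less_iff by (metis Suc_lessD not_less_eq less_SucE order_less_asym)

lemma exits_right_iff_keys:
  "exits_right (S t j) \<longleftrightarrow> (\<exists>\<kappa>\<in>keys (S t). \<kappa> div 2 = j \<and> dir (strand_of (S t) \<kappa>) = 1)"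
  by (rule exits_right_iff[OF not_crossing])

lemma exits_left_iff_keys:
  "exits_left (S t j) \<longleftrightarrow> (\<exists>\<kappa>\<in>keys (S t). \<kappa> div 2 = j \<and> dir (strand_of (S t) \<kappa>) = -1)"
  by (rule exits_left_iff[OF not_crossing])

text \<open>Continuity, read slot by slot: a slot is occupied exactly when some strand exits into
  it.\<close>

lemma next_key_image: "next_key (e t) (S t) ` keys (S t) = keys (S (Suc t))"
proof (intro set_eqI iffI)
  fix \<kappa>' assume "\<kappa>' \<in> next_key (e t) (S t) ` keys (S t)"
  then obtain \<kappa> where \<kappa>: "\<kappa> \<in> keys (S t)" "\<kappa>' = next_key (e t) (S t) \<kappa>" by blast
  show "\<kappa>' \<in> keys (S (Suc t))"
  proof (cases "dir (strand_of (S t) \<kappa>) = -1")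
    case True
    then have "exits_left (S t ((\<kappa> div 2 - 1) + 1))" using \<kappa> exits_left_iff_keys by auto
    then have "right_occupied (S (Suc t) (\<kappa> div 2 - 1 + e t))" using cont_right by blast
    moreover have "\<kappa>' = 2 * (\<kappa> div 2 - 1 + e t) + 1" using \<kappa> True by (simp add: next_key_def)
    ultimately show ?thesis by (simp only: keys_simps)
  next
    case False
    then have "exits_right (S t (\<kappa> div 2))" using \<kappa> exits_right_iff_keys dir_cases by blast
    then have "left_occupied (S (Suc t) (\<kappa> div 2 + e t))" using cont_left by blast
    moreover have "\<kappa>' = 2 * (\<kappa> div 2 + e t)" using \<kappa> False by (simp add: next_key_def)
    ultimately show ?thesis by (simp only: keys_simps)
  qed
next
  fix \<kappa>' assume "\<kappa>' \<in> keys (S (Suc t))"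
  then show "\<kappa>' \<in> next_key (e t) (S t) ` keys (S t)"
  proof (cases rule: keysE)
    case (left j)
    then have "exits_right (S t (j - e t))" using cont_left[of t "j - e t"] by simp
    then obtain \<kappa> where "\<kappa> \<in> keys (S t)" "\<kappa> div 2 = j - e t" "dir (strand_of (S t) \<kappa>) = 1"
      using exits_right_iff_keys by blast
    then show ?thesis using left by (intro image_eqI[of _ _ \<kappa>]) (auto simp: next_key_def)
  next
    case (right j)
    then have "exits_left (S t (j - e t + 1))" using cont_right[of t "j - e t"] by simp
    then obtain \<kappa> where "\<kappa> \<in> keys (S t)" "\<kappa> div 2 = j - e t + 1" "dir (strand_of (S t) \<kappa>) = -1"
      using exits_left_iff_keys by blast
    then show ?thesis using right by (intro image_eqI[of _ _ \<kappa>]) (auto simp: next_key_def)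
  qed
qed

lemma same_cell:
  assumes "\<kappa> \<in> keys (S t)" "\<kappa>' \<in> keys (S t)" "\<kappa> < \<kappa>'" "\<kappa> div 2 = \<kappa>' div 2"
  shows "S t (\<kappa> div 2) = S_S" "strand_of (S t) \<kappa> = SL" "strand_of (S t) \<kappa>' = SR"
proof -
  have \<kappa>: "\<kappa> = 2 * (\<kappa> div 2)" "\<kappa>' = 2 * (\<kappa> div 2) + 1" using assms(3,4) by presburger+
  then have "left_occupied (S t (\<kappa> div 2))" "right_occupied (S t (\<kappa> div 2))"
    using assms(1,2) by (metis keys_simps)+
  then show c: "S t (\<kappa> div 2) = S_S"
    by (cases rule: noncrossing_cases[OF not_crossing[of t "\<kappa> div 2"]]) (auto simp: cell_defs)
  have "even \<kappa>" "odd \<kappa>'" using \<kappa> by presburger+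
  then show "strand_of (S t) \<kappa> = SL" "strand_of (S t) \<kappa>' = SR"
    using c assms(4) by (auto simp: strand_of_def)
qed

text \<open>Two strands of one cell are \<open>SL\<close> and \<open>SR\<close> and separate.
  Strands of different cells can at most enter the same cell, and then from opposite sides.\<close>

lemma next_key_strict_mono: "strict_mono_on (keys (S t)) (next_key (e t) (S t))"
proof (rule strict_mono_onI)
  fix \<kappa> \<kappa>' assume k: "\<kappa> \<in> keys (S t)" "\<kappa>' \<in> keys (S t)" "\<kappa> < \<kappa>'"
  show "next_key (e t) (S t) \<kappa> < next_key (e t) (S t) \<kappa>'"
  proof (cases "\<kappa> div 2 = \<kappa>' div 2")
    case True
    then show ?thesis using same_cell[OF k True] by (simp add: next_key_def)
  next
    case False
    then have "\<kappa> div 2 < \<kappa>' div 2" using k(3) by linarith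
    then show ?thesis by (auto simp: next_key_def)
  qed
qed

text \<open>As an increasing bijection between occupied slots, \<open>next_key\<close> preserves the
  numbering of the strands.\<close>

lemma key_Suc: "i < n \<Longrightarrow> key (Suc t) i = next_key (e t) (S t) (key t i)"
  using sorted_list_of_set_image_strict_mono[OF finite_keys next_key_strict_mono, of t]
    card_keys[of t] by (simp add: key_def next_key_image)

lemma pos_Suc: "i < n \<Longrightarrow> pos (Suc t) i = pos t i + dir (kind t i)"
  using dir_cases[of "kind t i"] by (auto simp: pos_def key_Suc next_key_div kind_def)

lemma pos_order:
  assumes "Suc i < n"
  shows "pos t i < pos t (Suc i) \<or> pos t i = pos t (Suc i) \<and> kind t i = SL \<and> kind t (Suc i) = SR"
proof -
  have k: "key t i \<in> keys (S t)" "key t (Suc i) \<in> keys (S t)" "key t i < key t (Suc i)"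
    using assms key_in key_less by auto
  show ?thesis
  proof (cases "key t i div 2 = key t (Suc i) div 2")
    case True
    then show ?thesis using same_cell[OF k True] by (simp add: pos_def kind_def)
  next
    case False
    then have "key t i div 2 < key t (Suc i) div 2" using k(3) by linarith
    then show ?thesis by (simp add: pos_def)
  qed
qed

lemma state_of_cell:
  "\<kappa> \<in> keys (S t) \<Longrightarrow> state_of (S t (\<kappa> div 2)) = strand_state (strand_of (S t) \<kappa>)"
  by (cases rule: keysE, assumption; cases rule: noncrossing_cases[OF not_crossing[of t "\<kappa> div 2"]])
      (auto simp: cell_defs)

text \<open>A strand exiting left is the first of its cell. If the preceding cell is occupied,
  strand \<open>i - 1\<close> therefore lies in it.\<close>

lemma state_left:
  assumes i: "i < n" and d: "dir (kind t i) = -1"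
  shows "state_of (S t (key t i div 2 - 1)) = left_state pos kind t i"
proof (cases "0 < i \<and> pos t (i - 1) = pos t i - 2")
  case True
  then have "key t (i - 1) div 2 = key t i div 2 - 1" by (simp add: pos_def)
  then show ?thesis
    using state_of_cell[of "key t (i - 1)" t] key_in[of "i - 1" t] i True
    by (simp add: left_state_def kind_def)
next
  case False
  have "S t (key t i div 2 - 1) = N_N"
  proof (rule ccontr)
    assume "S t (key t i div 2 - 1) \<noteq> N_N"
    then obtain \<kappa> where \<kappa>: "\<kappa> \<in> keys (S t)" "\<kappa> div 2 = key t i div 2 - 1"
      using nonempty_iff_keys[of "S t" "key t i div 2 - 1"] by force
    then obtain j where j: "j < n" "key t j = \<kappa>" using key_surj by blast
    have "\<kappa> < key t i" using \<kappa>(2) by linarith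
    then have "j < i" using key_less_iff j i by blast
    then have le: "key t j \<le> key t (i - 1)" and less: "key t (i - 1) < key t i"
      using key_less[of j "i - 1" t] key_less[of "i - 1" i t] i by (cases "j = i - 1"; force)+
    have "key t (i - 1) div 2 \<noteq> key t i div 2"
    proof
      assume "key t (i - 1) div 2 = key t i div 2"
      then have "strand_of (S t) (key t i) = SR"
        using same_cell(3)[OF key_in key_in less] i by simp
      then show False using d by (simp add: kind_def)
    qed
    then have "key t (i - 1) div 2 = key t i div 2 - 1"
      using le less \<kappa> j(2) zdiv_mono1[OF le, of 2] zdiv_mono1[of "key t (i-1)" "key t i" 2]
        by linarith
    then show False using False \<open>j < i\<close> by (simp add: pos_def)
  qed
  then show ?thesis using False by (auto simp: left_state_def)
qed

lemma state_right:
  assumes i: "i < n" and d: "dir (kind t i) = 1"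
  shows "state_of (S t (key t i div 2 + 1)) = right_state n pos kind t i"
proof (cases "Suc i < n \<and> pos t (Suc i) = pos t i + 2")
  case True
  then have "key t (Suc i) div 2 = key t i div 2 + 1" by (simp add: pos_def)
  then show ?thesis
    using state_of_cell[of "key t (Suc i)" t] key_in[of "Suc i" t] i True
    by (simp add: right_state_def kind_def)
next
  case False
  have "S t (key t i div 2 + 1) = N_N"
  proof (rule ccontr)
    assume "S t (key t i div 2 + 1) \<noteq> N_N"
    then obtain \<kappa> where \<kappa>: "\<kappa> \<in> keys (S t)" "\<kappa> div 2 = key t i div 2 + 1"
      using nonempty_iff_keys[of "S t" "key t i div 2 + 1"] by force
    then obtain j where j: "j < n" "key t j = \<kappa>" using key_surj by blast
    have "key t i < \<kappa>" using \<kappa>(2) by linarith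
    then have "i < j" using key_less_iff j i by blast
    then have n: "Suc i < n" and le: "key t (Suc i) \<le> key t j" and less: "key t i < key t (Suc i)"
      using key_less[of "Suc i" j t] key_less[of i "Suc i" t] j by (cases "j = Suc i"; force)+
    have "key t i div 2 \<noteq> key t (Suc i) div 2"
    proof
      assume "key t i div 2 = key t (Suc i) div 2"
      then have "strand_of (S t) (key t i) = SL"
        using same_cell(2)[OF key_in key_in less] n by simp
      then show False using d by (simp add: kind_def)
    qed
    then have "key t (Suc i) div 2 = key t i div 2 + 1"
      using le less \<kappa> j(2) zdiv_mono1[OF le, of 2] zdiv_mono1[of "key t i" "key t (Suc i)" 2]
        by linarith
    then show False using False n by (simp add: pos_def)
  qed
  then show ?thesis using False by (auto simp: right_state_def)
qed

definition obeys :: "(cell_state \<Rightarrow> cell_state \<Rightarrow> bool) \<Rightarrow> bool" where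
  "obeys turns \<longleftrightarrow> (\<forall>t k. S (Suc t) (k + e t) \<noteq> N_N \<longrightarrow>
     state_of (S (Suc t) (k + e t)) =
       (if turns (state_of (S t k)) (state_of (S t (k + 1))) then St_T else St_S))"

lemma kind_Suc_left:
  assumes "obeys turns" and i: "i < n" and d: "dir (kind t i) = -1"
  shows "kind (Suc t) i = (if turns (left_state pos kind t i) (strand_state (kind t i)) then TL else
      SR)"
proof -
  let ?j = "key t i div 2 - 1 + e t"
  have k: "key (Suc t) i = 2 * ?j + 1" using d by (simp add: key_Suc[OF i] next_key_def kind_def)
  then have occ: "right_occupied (S (Suc t) ?j)" using key_in[OF i, of "Suc t"]
    by (metis keys_simps(2))
  then have "S (Suc t) ?j \<noteq> N_N" by (auto simp: cell_defs)
  then have "state_of (S (Suc t) ?j) = (if turns (state_of (S t (key t i div 2 - 1)))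
      (state_of (S t (key t i div 2 - 1 + 1))) then St_T else St_S)"
    using assms(1) unfolding obeys_def by blast
  moreover have "kind (Suc t) i = (if S (Suc t) ?j = N_L then TL else SR)"
    unfolding kind_def k by (simp only: strand_of_simps)
  moreover have "state_of (S (Suc t) ?j) = St_T \<longleftrightarrow> S (Suc t) ?j = N_L"
    using occ by (cases rule: noncrossing_cases[OF not_crossing[of "Suc t" ?j]]) (auto simp:
        cell_defs)
  ultimately show ?thesis
    using state_left[OF i d] state_of_cell[OF key_in[OF i], of t]
      by (auto simp: kind_def split: if_splits)
qed

lemma kind_Suc_right:
  assumes "obeys turns" and i: "i < n" and d: "dir (kind t i) = 1"
  shows "kind (Suc t) i = (if turns (strand_state (kind t i)) (right_state n pos kind t i) then TR
      else SL)"
proof -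
  let ?j = "key t i div 2 + e t"
  have k: "key (Suc t) i = 2 * ?j" using d by (simp add: key_Suc[OF i] next_key_def kind_def)
  then have occ: "left_occupied (S (Suc t) ?j)" using key_in[OF i, of "Suc t"]
    by (metis keys_simps(1))
  then have "S (Suc t) ?j \<noteq> N_N" by (auto simp: cell_defs)
  then have "state_of (S (Suc t) ?j) = (if turns (state_of (S t (key t i div 2)))
      (state_of (S t (key t i div 2 + 1))) then St_T else St_S)"
    using assms(1) unfolding obeys_def by blast
  moreover have "kind (Suc t) i = (if S (Suc t) ?j = R_N then TR else SL)"
    unfolding kind_def k by (simp only: strand_of_simps)
  moreover have "state_of (S (Suc t) ?j) = St_T \<longleftrightarrow> S (Suc t) ?j = R_N"
    using occ by (cases rule: noncrossing_cases[OF not_crossing[of "Suc t" ?j]]) (auto simp: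
        cell_defs)
  ultimately show ?thesis
    using state_right[OF i d] state_of_cell[OF key_in[OF i], of t]
      by (auto simp: kind_def split: if_splits)
qed

lemma off_period:
  assumes "\<And>t. e (t + P) = e t"
  shows "off (t + P) = off t + off P"
  by (induction t) (simp_all add: assms)

text \<open>Recurring generations have equal keys, so every strand is displaced by
  \<open>off P\<close>.\<close>

lemma strand_system:
  assumes "obeys turns" "0 < P" "\<And>t. S (t + P) = S t" "\<And>t. e (t + P) = e t"
  shows "strand_system n turns pos kind P (- off P)"
proof
  fix t i
  have key: "key (t + P) i = key t i" by (simp add: key_def assms)
  show "kind (t + P) i = kind t i" by (simp add: kind_def key assms)
  show "pos (t + P) i = pos t i - - off P" using off_period[OF assms(4)] by (simp add: pos_def key)
  show "even (pos t (Suc i) - pos t i)" by (simp add: pos_def)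
qed (use assms pos_Suc kind_Suc_left kind_Suc_right pos_order in auto)

end


section \<open>Deleting outer strands\<close>

context flow
begin

lemma key_strict_mono: "hi \<le> n \<Longrightarrow> strict_mono_on {lo..<hi} (key t)"
  by (intro strict_mono_onI key_less) auto

lemma key_inj: "i < n \<Longrightarrow> j < n \<Longrightarrow> key t i = key t j \<longleftrightarrow> i = j"
  using key_less_iff[of i j t] key_less_iff[of j i t] by auto

text \<open>Every nonempty child holds a strand, so a rule can be checked strand by strand. This
  yields the rules of subpatterns.\<close>

lemma obeysI:
  assumes left: "\<And>t i. i < n \<Longrightarrow> dir (kind t i) = -1 \<Longrightarrow>
      kind (Suc t) i = (if turns (left_state pos kind t i) (strand_state (kind t i)) then TL else
          SR)"
    and right: "\<And>t i. i < n \<Longrightarrow> dir (kind t i) = 1 \<Longrightarrow>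
      kind (Suc t) i = (if turns (strand_state (kind t i)) (right_state n pos kind t i) then TR else
          SL)"
  shows "obeys turns"
  unfolding obeys_def
proof (intro allI impI)
  fix t k assume "S (Suc t) (k + e t) \<noteq> N_N"
  then obtain \<kappa> where \<kappa>: "\<kappa> \<in> keys (S (Suc t))" "\<kappa> div 2 = k + e t"
    using nonempty_iff_keys[of "S (Suc t)" "k + e t"] by force
  then obtain i where i: "i < n" "key (Suc t) i = \<kappa>" using key_surj by blast
  have child: "state_of (S (Suc t) (k + e t)) = strand_state (kind (Suc t) i)"
    using state_of_cell[OF \<kappa>(1)] \<kappa>(2) i(2) by (simp add: kind_def)
  have k: "k = key t i div 2 - of_bool (dir (kind t i) = -1)"
  proof -
    have "\<kappa> div 2 = key t i div 2 + e t - of_bool (dir (kind t i) = -1)"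
      unfolding i(2)[symmetric] key_Suc[OF i(1)] next_key_div kind_def ..
    then show ?thesis using \<kappa>(2) by linarith
  qed
  have st: "state_of (S t (key t i div 2)) = strand_state (kind t i)"
    using state_of_cell[OF key_in[OF i(1)]] by (simp add: kind_def)
  show "state_of (S (Suc t) (k + e t)) =
      (if turns (state_of (S t k)) (state_of (S t (k + 1))) then St_T else St_S)"
  proof (cases "dir (kind t i) = -1")
    case True
    then show ?thesis using left[OF i(1) True] state_left[OF i(1) True] child st k by simp
  next
    case False
    then have d: "dir (kind t i) = 1" using dir_cases by blast
    then show ?thesis using right[OF i(1) d] state_right[OF i(1) d] child st k by simp
  qed
qed

text \<open>The kept strands stay in place: without renormalization the offsets \<open>e\<close> of
  the whole pattern still apply.\<close>

definition part :: "nat \<Rightarrow> nat \<Rightarrow> nat \<Rightarrow> generation" where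
  "part lo hi t = (\<lambda>j. keep (2 * j \<in> key t ` {lo..<hi}) (2 * j + 1 \<in> key t ` {lo..<hi}) (S t j))"

end

lemma keep_noncrossing:
  assumes "\<not> is_crossing c"
  shows "left_occupied (keep l r c) \<longleftrightarrow> l \<and> left_occupied c"
    and "right_occupied (keep l r c) \<longleftrightarrow> r \<and> right_occupied c"
    and "\<not> is_crossing (keep l r c)"
    and "left_occupied (keep l r c) \<Longrightarrow> keep l r c = R_N \<longleftrightarrow> c = R_N"
    and "right_occupied (keep l r c) \<Longrightarrow> keep l r c = N_L \<longleftrightarrow> c = N_L"
  using assms unfolding cell_cases_noncrossing by (auto simp: cell_defs split: if_splits)

lemma keep_cong:
  assumes "left_occupied c \<Longrightarrow> l = l'" "right_occupied c \<Longrightarrow> r = r'" "\<not> is_crossing c"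
  shows "keep l r c = keep l' r' c"
  using assms by (cases c) (auto simp: cell_defs)

context flow
begin

context
  fixes lo hi :: nat
  assumes lo_le: "lo \<le> hi" and hi_le: "hi \<le> n"
begin

lemma part_not_crossing: "\<not> is_crossing (part lo hi t j)"
  by (simp add: part_def keep_noncrossing not_crossing)

lemma keys_part: "keys (part lo hi t) = key t ` {lo..<hi}"
proof (intro set_eqI)
  fix \<kappa>
  have sub: "key t ` {lo..<hi} \<subseteq> keys (S t)" using key_in hi_le by auto
  show "\<kappa> \<in> keys (part lo hi t) \<longleftrightarrow> \<kappa> \<in> key t ` {lo..<hi}"
  proof (cases \<kappa> rule: key_cases)
    case (left j)
    have "\<kappa> \<in> keys (part lo hi t) \<longleftrightarrow> 2 * j \<in> key t ` {lo..<hi} \<and> 2 * j \<in> keys (S t)"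
      unfolding left keys_simps by (simp add: part_def keep_noncrossing not_crossing)
    then show ?thesis using sub unfolding left by blast
  next
    case (right j)
    have "\<kappa> \<in> keys (part lo hi t) \<longleftrightarrow> 2 * j + 1 \<in> key t ` {lo..<hi} \<and> 2 * j + 1 \<in> keys (S t)"
      unfolding right keys_simps by (simp add: part_def keep_noncrossing not_crossing)
    then show ?thesis using sub unfolding right by blast
  qed
qed

lemma strand_of_part:
  assumes "\<kappa> \<in> key t ` {lo..<hi}" shows "strand_of (part lo hi t) \<kappa> = strand_of (S t) \<kappa>"
proof -
  have "\<kappa> \<in> keys (part lo hi t)" using assms by (simp add: keys_part)
  then show ?thesis
    using keep_noncrossing[OF not_crossing]
    by (cases rule: keysE) (simp_all add: part_def)
qed

lemma key_image_Suc: "key (Suc t) ` {lo..<hi} = next_key (e t) (S t) ` key t ` {lo..<hi}"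
  using hi_le by (auto simp: key_Suc image_image)

text \<open>Each strand follows \<open>next_key\<close> on its own, so continuity survives the
  deletion of other strands.\<close>

lemma part_flow: "flow (part lo hi) e (hi - lo)"
proof
  fix t k
  have "exits_right (part lo hi t k) \<longleftrightarrow>
      (\<exists>\<kappa>\<in>key t ` {lo..<hi}. \<kappa> div 2 = k \<and> dir (strand_of (S t) \<kappa>) = 1)"
    using exits_right_iff[of "part lo hi t" k, OF part_not_crossing] strand_of_part
      by (simp add: keys_part)
  also have "\<dots> \<longleftrightarrow> 2 * (k + e t) \<in> key (Suc t) ` {lo..<hi}"
  proof -
    have "2 * (k + e t) = next_key (e t) (S t) \<kappa> \<longleftrightarrow> \<kappa> div 2 = k \<and> dir (strand_of (S t) \<kappa>) = 1" for \<kappa>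
      using dir_cases[of "strand_of (S t) \<kappa>"] by (auto simp: next_key_def; presburger)
    then show ?thesis unfolding key_image_Suc by (auto simp: image_iff)
  qed
  finally show "left_occupied (part lo hi (Suc t) (k + e t)) \<longleftrightarrow> exits_right (part lo hi t k)"
    by (simp flip: keys_simps(1) add: keys_part)
  have "exits_left (part lo hi t (k + 1)) \<longleftrightarrow>
      (\<exists>\<kappa>\<in>key t ` {lo..<hi}. \<kappa> div 2 = k + 1 \<and> dir (strand_of (S t) \<kappa>) = -1)"
    using exits_left_iff[of "part lo hi t" "k + 1", OF part_not_crossing] strand_of_part
      by (simp add: keys_part)
  also have "\<dots> \<longleftrightarrow> 2 * (k + e t) + 1 \<in> key (Suc t) ` {lo..<hi}"
  proof -
    have "2 * (k + e t) + 1 = next_key (e t) (S t) \<kappa> \<longleftrightarrow> \<kappa> div 2 = k + 1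
        \<and> dir (strand_of (S t) \<kappa>) = -1" for \<kappa>
      using dir_cases[of "strand_of (S t) \<kappa>"] by (auto simp: next_key_def; presburger)
    then show ?thesis unfolding key_image_Suc by (auto simp: image_iff)
  qed
  finally show "right_occupied (part lo hi (Suc t) (k + e t)) \<longleftrightarrow> exits_left (part lo hi t (k + 1))"
    by (simp flip: keys_simps(2) add: keys_part)
  show "\<not> is_crossing (part lo hi t k)" by (rule part_not_crossing)
  show "finite (keys (part lo hi t))" by (simp add: keys_part)
  show "card (keys (part lo hi t)) = hi - lo"
    using strict_mono_on_imp_inj_on[OF key_strict_mono[OF hi_le]]
      by (simp add: keys_part card_image)
qed

interpretation part: flow "part lo hi" e "hi - lo" by (rule part_flow)

lemma part_key: "i < hi - lo \<Longrightarrow> part.key t i = key t (lo + i)"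
  using sorted_list_of_set_image_strict_mono[OF _ key_strict_mono[OF hi_le], of lo t]
  by (simp add: part.key_def keys_part)

lemma part_kind: "i < hi - lo \<Longrightarrow> part.kind t i = kind t (lo + i)"
  by (simp add: part.kind_def kind_def part_key strand_of_part)

lemma part_pos: "i < hi - lo \<Longrightarrow> part.pos t i = pos t (lo + i)"
  by (simp add: part.pos_def pos_def part_key)

text \<open>Deleting strands only changes the state of the parent on the other side of an outermost
  remaining strand, to empty.\<close>

lemma part_obeys:
  assumes obeys: "obeys turns"
    and right: "hi = n \<or> \<not> turns St_S St_E \<and> (\<forall>t i. i < n \<longrightarrow> kind t i \<noteq> TR)"
    and left: "lo = 0 \<or> \<not> turns St_E St_S \<and> (\<forall>t i. i < n \<longrightarrow> kind t i \<noteq> TL)"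
  shows "part.obeys turns"
proof (rule part.obeysI)
  fix t i assume i: "i < hi - lo"
  then have n: "lo + i < n" using hi_le by simp
  show "part.kind (Suc t) i = (if turns (left_state part.pos part.kind t i)
      (strand_state (part.kind t i)) then TL else SR)" if d: "dir (part.kind t i) = -1"
  proof (cases "i = 0 \<and> lo \<noteq> 0")
    \<comment> \<open>The left parent may have become empty. Without \<open>TL\<close> the strand
      becomes \<open>SR\<close>, in agreement with \<open>ES\<close> not turning.\<close>
    case True
    then have "kind t lo = SL" "kind (Suc t) lo \<noteq> TL"
      using d left n i by (cases "kind t lo"; auto simp: part_kind)+
    then have "kind (Suc t) lo = SR" using kind_Suc_left[OF obeys n, of t] True
      by (auto split: if_splits)
    then show ?thesis using True i left \<open>kind t lo = SL\<close> by (simp add: part_kind left_state_def)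
  next
    case False
    then have "left_state part.pos part.kind t i = left_state pos kind t (lo + i)"
      using i by (auto simp: left_state_def part_kind part_pos)
    then show ?thesis using kind_Suc_left[OF obeys n, of t] d i by (simp add: part_kind)
  qed
  show "part.kind (Suc t) i = (if turns (strand_state (part.kind t i))
      (right_state (hi - lo) part.pos part.kind t i) then TR else SL)" if d: "dir (part.kind t i) =
          1"
  proof (cases "Suc (lo + i) = hi \<and> hi \<noteq> n")
    \<comment> \<open>Likewise, without \<open>TR\<close> the strand becomes \<open>SL\<close>, in
      agreement with \<open>SE\<close> not turning.\<close>
    case True
    then have "kind t (lo + i) = SR" "kind (Suc t) (lo + i) \<noteq> TR"
      using d right n i by (cases "kind t (lo + i)"; auto simp: part_kind)+
    moreover have "kind (Suc t) (lo + i) = SL"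
      using kind_Suc_right[OF obeys n, of t] calculation by (auto split: if_splits)
    moreover have "right_state (hi - lo) part.pos part.kind t i = St_E"
      using True by (auto simp: right_state_def)
    ultimately show ?thesis using True i right by (simp add: part_kind)
  next
    case False
    then have "Suc (lo + i) < n \<longleftrightarrow> Suc i < hi - lo" using i hi_le by linarith
    then have "right_state (hi - lo) part.pos part.kind t i = right_state n pos kind t (lo + i)"
      using i by (simp add: right_state_def part_kind part_pos cong: conj_cong if_cong)
    then show ?thesis using kind_Suc_right[OF obeys n, of t] d i by (simp add: part_kind)
  qed
qed

end

end

section \<open>The first and last strands as ranges of indices\<close>

lemma strands_in_eq_card:
  assumes "finite (keys \<delta>)"
  shows "strands_in \<delta> A = card {\<kappa> \<in> keys \<delta>. \<kappa> div 2 \<in> A}"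
proof -
  let ?J = "{j \<in> A. \<delta> j \<noteq> N_N}"
  let ?C = "\<lambda>j. {\<kappa> \<in> keys \<delta>. \<kappa> div 2 = j}"
  have C: "?C j = (if left_occupied (\<delta> j) then {2 * j} else {}) \<union>
      (if right_occupied (\<delta> j) then {2 * j + 1} else {})" for j
    by (auto elim!: keysE)
  have "?J \<subseteq> (\<lambda>\<kappa>. \<kappa> div 2) ` keys \<delta>"
  proof
    fix j assume "j \<in> ?J"
    then have "2 * j \<in> keys \<delta> \<or> 2 * j + 1 \<in> keys \<delta>" using nonempty_iff_keys by blast
    then show "j \<in> (\<lambda>\<kappa>. \<kappa> div 2) ` keys \<delta>" by (force simp del: keys_simps)
  qed
  then have fin: "finite ?J" using assms finite_surj by blast
  have "{\<kappa> \<in> keys \<delta>. \<kappa> div 2 \<in> A} = (\<Union>j\<in>?J. ?C j)"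
  proof (intro set_eqI iffI)
    fix \<kappa> assume \<kappa>: "\<kappa> \<in> {\<kappa> \<in> keys \<delta>. \<kappa> div 2 \<in> A}"
    then have "\<delta> (\<kappa> div 2) \<noteq> N_N" by (auto elim!: keysE simp: cell_defs)
    with \<kappa> show "\<kappa> \<in> (\<Union>j\<in>?J. ?C j)" by auto
  qed auto
  also have "card \<dots> = (\<Sum>j\<in>?J. card (?C j))"
    using fin assms by (intro card_UN_disjoint) auto
  also have "\<dots> = strands_in \<delta> A"
    unfolding strands_in_def by (intro sum.cong) (auto simp: C cell_strands_def)
  finally show ?thesis by simp
qed

context flow
begin

lemma rank_below:
  assumes "i < n" shows "card {\<kappa> \<in> keys (S t). \<kappa> < key t i} = i"
  using card_less_nth_sorted_list_of_set[OF finite_keys, of i t] assms card_keys[of t]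
    by (simp add: key_def)

lemma rank_above:
  assumes "i < n" shows "card {\<kappa> \<in> keys (S t). key t i < \<kappa>} = n - Suc i"
proof -
  have "keys (S t) = insert (key t i) ({\<kappa> \<in> keys (S t). \<kappa> < key t i} \<union> {\<kappa> \<in> keys (S t). key t i <
      \<kappa>})"
    using key_in[OF assms] by auto
  then have "n = card (insert (key t i) ({\<kappa> \<in> keys (S t). \<kappa> < key t i} \<union> {\<kappa> \<in> keys (S t). key t i <
      \<kappa>}))"
    using card_keys[of t] by simp
  also have "\<dots> = Suc (i + card {\<kappa> \<in> keys (S t). key t i < \<kappa>})"
  proof -
    have "card ({\<kappa> \<in> keys (S t). \<kappa> < key t i} \<union> {\<kappa> \<in> keys (S t). key t i < \<kappa>}) =
        i + card {\<kappa> \<in> keys (S t). key t i < \<kappa>}"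
      using finite_keys[of t] rank_below[OF assms, of t] by (subst card_Un_disjoint) auto
    then show ?thesis using finite_keys[of t] by (subst card_insert_disjoint) auto
  qed
  finally show ?thesis by simp
qed

lemma first_strands_eq_part:
  assumes "k \<le> n" shows "first_strands k (S t) = part 0 k t"
proof
  fix j
  have mem: "2 * j + b \<in> key t ` {0..<k} \<longleftrightarrow> card {\<kappa> \<in> keys (S t). \<kappa> < 2 * j + b} < k"
    if occ: "2 * j + b \<in> keys (S t)" for b
  proof -
    obtain i where i: "i < n" "key t i = 2 * j + b" using key_surj[OF occ] by blast
    then have "2 * j + b \<in> key t ` {0..<k} \<longleftrightarrow> i < k" using key_inj assms
      by (auto simp flip: i(2) simp: image_iff)
    then show ?thesis using rank_below[OF i(1), of t] i by simp
  qed
  have l: "strands_in (S t) {..<j} = card {\<kappa> \<in> keys (S t). \<kappa> < 2 * j + 0}"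
    unfolding strands_in_eq_card[OF finite_keys] by (rule arg_cong[of _ _ card]) auto
  have r: "strands_in (S t) {..<j} + of_bool (left_occupied (S t j)) = card {\<kappa> \<in> keys (S t). \<kappa> < 2 *
      j + 1}"
  proof -
    have "{\<kappa> \<in> keys (S t). \<kappa> < 2 * j + 1} = (if left_occupied (S t j) then insert (2 * j) else id)
        {\<kappa> \<in> keys (S t). \<kappa> < 2 * j + 0}"
      by (auto simp: le_less)
    then show ?thesis using finite_keys[of t] unfolding l by simp
  qed
  show "first_strands k (S t) j = part 0 k t j"
    unfolding first_strands_def part_def
    by (rule keep_cong) (use mem[of 0] mem[of 1] l r not_crossing in auto)
qed

lemma last_strands_eq_part:
  assumes "k \<le> n" shows "last_strands k (S t) = part (n - k) n t"
proof
  fix j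
  have mem: "2 * j + b \<in> key t ` {n - k..<n} \<longleftrightarrow> card {\<kappa> \<in> keys (S t). 2 * j + b < \<kappa>} < k"
    if occ: "2 * j + b \<in> keys (S t)" for b
  proof -
    obtain i where i: "i < n" "key t i = 2 * j + b" using key_surj[OF occ] by blast
    then have "2 * j + b \<in> key t ` {n - k..<n} \<longleftrightarrow> n - k \<le> i"
      using key_inj assms by (auto simp flip: i(2) simp: image_iff)
    then show ?thesis using rank_above[OF i(1), of t] i assms by auto
  qed
  have r: "strands_in (S t) {j<..} = card {\<kappa> \<in> keys (S t). 2 * j + 1 < \<kappa>}"
    unfolding strands_in_eq_card[OF finite_keys] by (rule arg_cong[of _ _ card]) auto
  have l: "strands_in (S t) {j<..} + of_bool (right_occupied (S t j)) = card {\<kappa> \<in> keys (S t). 2 * j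
      + 0 < \<kappa>}"
  proof -
    have "{\<kappa> \<in> keys (S t). 2 * j + 0 < \<kappa>} = (if right_occupied (S t j) then insert (2 * j + 1) else
        id)
        {\<kappa> \<in> keys (S t). 2 * j + 1 < \<kappa>}"
      by (auto simp: less_le)
    then show ?thesis using finite_keys[of t] unfolding r by simp
  qed
  show "last_strands k (S t) j = part (n - k) n t j"
    unfolding last_strands_def part_def
    by (rule keep_cong) (use mem[of 0] mem[of 1] l r not_crossing in auto)
qed

end


section \<open>Normalization, null chains and speed\<close>

context flow
begin

definition lead :: "nat \<Rightarrow> int" where
  "lead t = key t 0 div 2"

lemma lead_nonempty: "0 < n \<Longrightarrow> S t (lead t) \<noteq> N_N"
  using key_nonempty[OF key_in] by (simp add: lead_def)

lemma lead_le:
  assumes "S t j \<noteq> N_N" shows "lead t \<le> j"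
proof -
  obtain \<kappa> where \<kappa>: "\<kappa> \<in> keys (S t)" "\<kappa> div 2 = j"
    using nonempty_key[of "S t" j, OF assms] by blast
  then obtain i where i: "i < n" "key t i = \<kappa>" using key_surj by blast
  then have "key t 0 \<le> key t i" using key_less[of 0 i t] by (cases "i = 0") auto
  then show ?thesis using zdiv_mono1[of "key t 0" "key t i" 2] i \<kappa> by (simp add: lead_def)
qed

lemma finite_nonempty: "finite {j. S t j \<noteq> N_N}"
proof -
  have "{j. S t j \<noteq> N_N} \<subseteq> (\<lambda>\<kappa>. \<kappa> div 2) ` keys (S t)"
    using nonempty_key[of "S t"] by blast
  then show ?thesis using finite_keys finite_surj by blast
qed

lemma Min_nonempty: "0 < n \<Longrightarrow> Min {j. S t j \<noteq> N_N} = lead t"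
  using lead_nonempty lead_le finite_nonempty by (intro Min_eqI) auto

lemma normalize_gen_eq: "0 < n \<Longrightarrow> normalize_gen (S t) = (\<lambda>j. S t (j + lead t))"
  by (simp add: normalize_gen_def Min_nonempty)

lemma exits_left_lead:
  assumes "0 < n" shows "exits_left (S t (lead t)) \<longleftrightarrow> dir (kind t 0) = -1"
proof
  assume "exits_left (S t (lead t))"
  then obtain \<kappa> where \<kappa>: "\<kappa> \<in> keys (S t)" "\<kappa> div 2 = lead t" "dir (strand_of (S t) \<kappa>) = -1"
    using exits_left_iff_keys by blast
  then obtain i where i: "i < n" "key t i = \<kappa>" using key_surj by blast
  show "dir (kind t 0) = -1"
  proof (cases "i = 0")
    case True
    then show ?thesis using \<kappa> i by (simp add: kind_def)
  next
    case False
    then have "key t 0 < \<kappa>" using key_less[of 0 i t] i by simp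
    then have "strand_of (S t) \<kappa> = SR"
      using same_cell(3)[OF key_in[OF assms] \<kappa>(1)] \<kappa>(2) by (simp add: lead_def)
    then show ?thesis using \<kappa> by simp
  qed
next
  assume "dir (kind t 0) = -1"
  then show "exits_left (S t (lead t))"
    using exits_left_iff_keys key_in[OF assms] by (auto simp: lead_def kind_def)
qed

lemma lead_Suc: "0 < n \<Longrightarrow> lead (Suc t) = lead t + e t - of_bool (dir (kind t 0) = -1)"
  by (simp add: lead_def key_Suc next_key_div kind_def)

definition gap_width :: "nat \<Rightarrow> nat \<Rightarrow> int" where
  "gap_width t i = key t (Suc i) div 2 - key t i div 2"

text \<open>For periodic patterns this is the absence of null chains, in a form that passes to
  consecutive strands.\<close>

definition tight :: bool where
  "tight \<longleftrightarrow> (\<forall>i. Suc i < n \<longrightarrow> (\<exists>t. gap_width t i \<le> 1))"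

end

text \<open>Subpatterns are renormalized in every generation; \<open>S\<close> keeps the positions
  of the cells comparable.\<close>

locale normalized_flow = flow +
  fixes g :: pattern
  assumes n_pos: "0 < n" and g_nth: "g !! t = normalize_gen (S t)"
begin

lemma g_cell: "(g !! t) j = S t (j + lead t)"
  by (simp add: g_nth normalize_gen_eq[OF n_pos])

text \<open>The leading cell moves by exactly the amount that \<open>child_pos\<close> accounts for,
  so normalization does not change which cell is a child of which.\<close>

lemma child_pos_eq: "child_pos (g !! t) j + lead (Suc t) = j + lead t + e t"
  by (simp add: child_pos_def g_cell exits_left_lead[OF n_pos] lead_Suc[OF n_pos])

lemma child_eq: "child g t j = S (Suc t) (j + lead t + e t)"
  unfolding child_def g_cell child_pos_eq ..

lemma continuous: "continuous_pattern g"
proof -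
  have "j + 1 + lead t = j + lead t + 1" for j t by simp
  then show ?thesis
    unfolding continuous_pattern_def child_eq g_cell by (simp only: cont_left cont_right simp_thms)
qed

lemma crossing_rule: "crossing_rule_of c g"
  by (simp add: crossing_rule_of_def child_eq not_crossing)

lemma keys_g: "keys (g !! t) = (\<lambda>\<kappa>. \<kappa> - 2 * lead t) ` keys (S t)"
proof (intro set_eqI)
  fix \<kappa>
  have "\<kappa> \<in> keys (g !! t) \<longleftrightarrow> \<kappa> + 2 * lead t \<in> keys (S t)"
    by (simp add: keys_def g_cell add.commute)
  also have "\<dots> \<longleftrightarrow> \<kappa> \<in> (\<lambda>\<kappa>. \<kappa> - 2 * lead t) ` keys (S t)"
    by (auto simp: image_iff intro: bexI[of _ "\<kappa> + 2 * lead t"])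
  finally show "\<kappa> \<in> keys (g !! t) \<longleftrightarrow> \<kappa> \<in> (\<lambda>\<kappa>. \<kappa> - 2 * lead t) ` keys (S t)" .
qed

lemma generation: "is_generation n (g !! t)"
proof -
  have fin: "finite (keys (g !! t))" using finite_keys by (simp add: keys_g)
  have "card (keys (g !! t)) = n"
    unfolding keys_g by (subst card_image) (auto simp: card_keys inj_on_def)
  then have "strands_in (g !! t) UNIV = n" using strands_in_eq_card[OF fin] by simp
  moreover have "{j. (g !! t) j \<noteq> N_N} = (\<lambda>j. j - lead t) ` {j. S t j \<noteq> N_N}"
    by (force simp: g_cell image_iff intro: exI[of _ "_ + lead t"])
  then have "finite {j. (g !! t) j \<noteq> N_N}" using finite_nonempty by simp
  moreover have "(g !! t) j = N_N" if "j < 0" for j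
    using lead_le[of t "j + lead t"] that by (force simp: g_cell)
  moreover have "(g !! t) 0 \<noteq> N_N" using lead_nonempty[OF n_pos] by (simp add: g_cell)
  ultimately show ?thesis by (simp add: is_generation_def)
qed

lemma turning_rule_iff:
  "turning_rule_of r g \<longleftrightarrow> turning_rule r \<and> obeys (\<lambda>A B. r ! bit_index A B)"
proof -
  have "(\<forall>t j. child g t j \<noteq> N_N \<longrightarrow> state_of (child g t j) =
      (if r ! bit_index (state_of ((g !! t) j)) (state_of ((g !! t) (j + 1))) then St_T else St_S))
    \<longleftrightarrow> obeys (\<lambda>A B. r ! bit_index A B)" (is "?L \<longleftrightarrow> ?R")
  proof
    assume ?L
    show ?R
      unfolding obeys_def
    proof (intro allI)
      fix t k
      show "S (Suc t) (k + e t) \<noteq> N_N \<longrightarrow> state_of (S (Suc t) (k + e t)) =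
          (if r ! bit_index (state_of (S t k)) (state_of (S t (k + 1))) then St_T else St_S)"
        using \<open>?L\<close>[rule_format, of t "k - lead t"] by (simp add: child_eq g_cell algebra_simps)
    qed
  next
    assume ?R
    show ?L
    proof (intro allI)
      fix t j
      show "child g t j \<noteq> N_N \<longrightarrow> state_of (child g t j) =
          (if r ! bit_index (state_of ((g !! t) j)) (state_of ((g !! t) (j + 1))) then St_T else
              St_S)"
        using \<open>?R\<close>[unfolded obeys_def, rule_format, of t "j + lead t"]
        by (simp add: child_eq g_cell algebra_simps)
    qed
  qed
  then show ?thesis by (simp add: turning_rule_of_def)
qed

lemma sca: "sca_pattern n g \<longleftrightarrow> (\<exists>r. turning_rule_of r g)"
  using generation continuous crossing_rule by (auto simp: sca_pattern_def grid_pattern_def)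

text \<open>A straight strand does not count for the speed but moves by half a cell. The sign
  attached to its slot corrects this and telescopes in sums.\<close>

lemma lead_shift_eq:
  "2 * lead_shift (g !! t) = - 2 * dir (kind t 0) + (if even (key (Suc t) 0) then 1 else -1)
     - (if even (key t 0) then 1 else -1)"
proof -
  have cell: "(g !! t) 0 = S t (key t 0 div 2)" by (simp add: g_cell lead_def)
  have parity: "even (key (Suc t) 0) \<longleftrightarrow> dir (kind t 0) \<noteq> -1"
    using n_pos by (simp add: key_Suc next_key_def kind_def)
  show ?thesis
    using key_in[OF n_pos, of t]
  proof (cases rule: keysE)
    case (left j)
    then show ?thesis
      using cell parity unfolding kind_def left(1) strand_of_simps
      by (cases rule: noncrossing_cases[OF not_crossing[of t j]]) (auto simp: lead_shift_def
          cell_defs)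
  next
    case (right j)
    then show ?thesis
      using cell parity unfolding kind_def right(1) strand_of_simps
      by (cases rule: noncrossing_cases[OF not_crossing[of t j]]) (auto simp: lead_shift_def
          cell_defs)
  qed
qed

lemma gap_width_cong:
  assumes "g !! s = g !! t" "Suc i < n" shows "gap_width s i = gap_width t i"
proof -
  have nkey: "key u i = sorted_list_of_set (keys (g !! u)) ! i + 2 * lead u" if "i < n" for u i
  proof -
    have "sorted_list_of_set (keys (g !! u)) = map (\<lambda>\<kappa>. \<kappa> - 2 * lead u) (sorted_list_of_set (keys (S
        u)))"
      unfolding keys_g by (rule sorted_list_of_set_image_strict_mono[OF finite_keys]) (auto intro:
          strict_mono_onI)
    then show ?thesis using that card_keys[of u] by (simp add: key_def)
  qed
  then show ?thesis using assms by (simp add: gap_width_def)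
qed

context
  assumes periodic: "periodic g"
begin

lemma per_props: "per g \<noteq> []" "g = cycle (per g)"
proof -
  obtain a where "a \<noteq> [] \<and> g = cycle a" using periodic by (auto simp: periodic_def)
  then have "per g \<noteq> [] \<and> g = cycle (per g)" unfolding per_def by (rule arg_min_natI)
  then show "per g \<noteq> []" "g = cycle (per g)" by blast+
qed

lemma g_period: "g !! (t + length (per g)) = g !! t"
proof -
  have "g = per g @- g" using cycle_decomp[OF per_props(1)] per_props(2) by metis
  then have "g !! (t + length (per g)) = (per g @- g) !! (t + length (per g))" by simp
  also have "\<dots> = g !! t" by simp
  finally show ?thesis .
qed

lemma g_mod: "g !! (t mod length (per g)) = g !! t"
proof (induction t rule: less_induct)
  case (less t)
  show ?case
  proof (cases "t < length (per g)")
    case False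
    then have "t - length (per g) < t" using per_props(1) by (cases "per g") auto
    then have "g !! ((t - length (per g)) mod length (per g)) = g !! (t - length (per g))"
      by (rule less.IH)
    then show ?thesis using g_period[of "t - length (per g)"] False by (simp add: mod_if)
  qed simp
qed

lemma per_nth:
  assumes "t < length (per g)" shows "per g ! t = g !! t"
proof -
  have "g = per g @- g" using cycle_decomp[OF per_props(1)] per_props(2) by metis
  then have "g !! t = (per g @- g) !! t" by simp
  then show ?thesis using assms by simp
qed

text \<open>The chain moves by the same two amounts as strands do and avoids occupied cells, so it
  stays between two fixed strands, which never close up.\<close>

lemma null_chain_gap:
  assumes "null_chain (per g) cs"
  shows "\<not> tight"
proof -
  let ?q = "length (per g)"
  define y where "y t = cs ! t + lead t" for t
  have q: "0 < ?q" using per_props by simp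
  have empty: "S t (y t) = N_N" if "t < ?q" for t
    using assms that by (auto simp: null_chain_def y_def per_nth g_cell)
  have step: "y (Suc t) = y t + e t \<or> y (Suc t) = y t - 1 + e t" if "Suc t < ?q" for t
  proof -
    have "cs ! Suc t = child_pos (g !! t) (cs ! t) \<or> cs ! Suc t = child_pos (g !! t) (cs ! t - 1)"
      using assms that per_nth[of t] by (auto simp: null_chain_def)
    then show ?thesis using child_pos_eq[of t "cs ! t"] child_pos_eq[of t "cs ! t - 1"]
      by (auto simp: y_def)
  qed
  have "\<exists>j<cs ! 0. (g !! 0) j \<noteq> N_N" "\<exists>j>cs ! 0. (g !! 0) j \<noteq> N_N"
    using assms per_nth[OF q] by (auto simp: null_chain_def)
  then obtain a b where "a < cs ! 0" "(g !! 0) a \<noteq> N_N" "cs ! 0 < b" "(g !! 0) b \<noteq> N_N" by blast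
  then obtain jl jr where jl: "jl < y 0" "S 0 jl \<noteq> N_N" and jr: "y 0 < jr" "S 0 jr \<noteq> N_N"
    using that[of "a + lead 0" "b + lead 0"] unfolding y_def g_cell by linarith
  have strand: "\<exists>i<n. key 0 i div 2 = j" if "S 0 j \<noteq> N_N" for j
    using nonempty_key[of "S 0" j, OF that] key_surj[of _ 0] by blast
  have mono: "key t i div 2 \<le> key t j div 2" if "i \<le> j" "j < n" for t i j
    using key_less[of i j t] that by (cases "i = j") (auto intro: zdiv_mono1)
  have occ: "S t (key t i div 2) \<noteq> N_N" if "i < n" for t i
    by (rule key_nonempty[OF key_in[OF that]])
  define L where "L = {i. i < n \<and> key 0 i div 2 < y 0}"
  \<comment> \<open>The last strand to the left of the start of the chain.\<close>
  define i where "i = Max L"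
  have "finite L" "L \<noteq> {}" using strand[OF jl(2)] jl(1) by (auto simp: L_def)
  then have iL: "i \<in> L" and max: "\<And>k. k \<in> L \<Longrightarrow> k \<le> i" unfolding i_def by (auto intro: Max_in)
  obtain r where r: "r < n" "key 0 r div 2 = jr" using strand[OF jr(2)] by blast
  have "i < r" using mono[of r i 0] r jr iL by (force simp: L_def not_less[symmetric])
  then have n: "Suc i < n" using r by simp
  have "Suc i \<notin> L" using max by fastforce
  then have "y 0 \<le> key 0 (Suc i) div 2" using n by (simp add: L_def)
  moreover have "y 0 \<noteq> key 0 (Suc i) div 2" using occ[OF n] empty[OF q] by metis
  ultimately have start: "key 0 i div 2 < y 0 \<and> y 0 < key 0 (Suc i) div 2" using iL
    by (simp add: L_def)
  have between: "key t i div 2 < y t \<and> y t < key t (Suc i) div 2" if "t < ?q" for t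
    using that
  proof (induction t)
    case 0
    show ?case by (rule start)
  next
    case (Suc t)
    have "key (Suc t) i div 2 \<le> key t i div 2 + e t" "key t (Suc i) div 2 + e t - 1 \<le> key (Suc t)
        (Suc i) div 2"
      using n by (simp_all add: key_Suc next_key_div)
    then have "key (Suc t) i div 2 \<le> y (Suc t) \<and> y (Suc t) \<le> key (Suc t) (Suc i) div 2"
      using Suc step[OF Suc.prems] by auto
    moreover have "y (Suc t) \<noteq> key (Suc t) i div 2" "y (Suc t) \<noteq> key (Suc t) (Suc i) div 2"
      using occ[of i "Suc t"] occ[OF n, of "Suc t"] empty[OF Suc.prems] n by auto
    ultimately show ?case by linarith
  qed
  have "2 \<le> gap_width t i" for t
  proof -
    have "2 \<le> gap_width (t mod ?q) i" using between[of "t mod ?q"] q by (simp add: gap_width_def)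
    then show ?thesis using gap_width_cong[OF g_mod n] by simp
  qed
  then have "\<not> gap_width t i \<le> 1" for t by (simp add: not_le order_less_le_trans[of 1 2])
  then show ?thesis using n unfolding tight_def by blast
qed

text \<open>A gap which never closes contains the null chain that follows the strand on its left.\<close>

lemma gap_null_chain:
  assumes "\<not> tight"
  shows "\<exists>cs. null_chain (per g) cs"
proof -
  let ?q = "length (per g)"
  obtain i where n: "Suc i < n" and "\<forall>t. \<not> gap_width t i \<le> 1"
    using assms unfolding tight_def by blast
  then have gap: "2 \<le> gap_width t i" for t
    by (metis int_one_le_iff_zero_less not_le one_add_one zless_imp_add1_zle)
  \<comment> \<open>The cell to the right of strand \<open>i\<close>, in the coordinates of
    \<open>g\<close>.\<close>
  define y where "y t = key t i div 2 + 1 - lead t" for t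
  have occ: "S t (key t i div 2) \<noteq> N_N" if "i < n" for t i
    by (rule key_nonempty[OF key_in[OF that]])
  have empty: "(g !! t) (y t) = N_N" for t
  proof (rule ccontr)
    assume "(g !! t) (y t) \<noteq> N_N"
    then have "S t (key t i div 2 + 1) \<noteq> N_N" by (simp add: g_cell y_def)
    then obtain \<kappa> where \<kappa>: "\<kappa> \<in> keys (S t)" "\<kappa> div 2 = key t i div 2 + 1"
      using nonempty_key[of "S t"] by blast
    have "key t i < \<kappa>" "\<kappa> < key t (Suc i)" using \<kappa>(2) gap[of t] unfolding gap_width_def by linarith+
    then show False using key_gap[of i "Suc i" t \<kappa>] n \<kappa>(1) by simp
  qed
  have "(g !! 0) (y 0 - 1) \<noteq> N_N" using occ[of i 0] n unfolding g_cell y_def by simp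
  moreover have "(g !! 0) (key 0 (Suc i) div 2 - lead 0) \<noteq> N_N" using occ[OF n, of 0]
    unfolding g_cell by simp
  moreover have "y 0 < key 0 (Suc i) div 2 - lead 0" using gap[of 0]
    by (simp add: y_def gap_width_def)
  ultimately have sides: "\<exists>j<y 0. (g !! 0) j \<noteq> N_N" "\<exists>j>y 0. (g !! 0) j \<noteq> N_N"
    by (metis zless_iff_Suc_zadd add_diff_cancel_right' diff_add_cancel less_add_one, blast)
  have step: "y (Suc t) = child_pos (g !! t) (y t) \<or> y (Suc t) = child_pos (g !! t) (y t - 1)" for t
    using child_pos_eq[of t "y t"] child_pos_eq[of t "y t - 1"] n
    by (cases "dir (strand_of (S t) (key t i)) = -1") (auto simp: y_def key_Suc next_key_div)
  have q: "0 < ?q" using per_props by simp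
  have "null_chain (per g) (map y [0..<?q])"
    using q empty sides step per_nth[OF q] by (auto simp: null_chain_def per_nth)
  then show ?thesis by blast
qed

text \<open>\<open>P\<close> need not be the shortest period of \<open>g\<close>, so the sums are
  compared over \<open>P * length (per g)\<close> generations.\<close>

lemma speed_period:
  assumes "0 < P" "\<And>t. S (t + P) = S t"
  shows "int P * fst (speed g) = int (length (per g)) * (pos 0 0 - pos P 0)"
proof -
  let ?f = "\<lambda>t. lead_shift (g !! t)" and ?q = "length (per g)"
  let ?s = "\<lambda>t. if even (key t 0) then 1 else -1 :: int"
  have sum: "2 * (\<Sum>t<m. ?f t) = - 2 * (pos m 0 - pos 0 0) + ?s m - ?s 0" for m
  proof (induction m)
    case (Suc m)
    then show ?case using lead_shift_eq[of m] pos_Suc[OF n_pos, of m] by (simp add: algebra_simps)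
  qed simp
  have mult: "(\<Sum>t<m * p. ?f t) = int m * (\<Sum>t<p. ?f t)" if "\<And>t. g !! (t + p) = g !! t" for m p
  proof -
    have shift: "g !! (t + k * p) = g !! t" for t k
    proof (induction k)
      case (Suc k)
      have "t + Suc k * p = (t + k * p) + p" by simp
      then show ?case using that[of "t + k * p"] Suc by (simp only:)
    qed simp
    show ?thesis
    proof (induction m)
      case (Suc m)
      have "(\<Sum>t<Suc m * p. ?f t) = (\<Sum>t<m * p. ?f t) + (\<Sum>t<p. ?f (t + m * p))"
        using sum.nat_group[of ?f p "Suc m"] sum.atLeastLessThan_concat[of 0 "m * p" "Suc m * p" ?f]
          sum.shift_bounds_nat_ivl[of ?f 0 "m * p" p]
        by (simp add: atLeast0LessThan add.commute)
      then show ?case using Suc by (simp add: shift algebra_simps)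
    qed simp
  qed
  have "key P 0 = key 0 0" using assms(2)[of 0] by (simp add: key_def)
  then have "(\<Sum>t<P. ?f t) = - (pos P 0 - pos 0 0)" using sum[of P] by simp
  moreover have "map lead_shift (per g) = map ?f [0..<?q]"
    by (rule nth_equalityI) (auto simp: per_nth)
  then have "fst (speed g) = (\<Sum>t<?q. ?f t)"
    by (simp add: speed_def interv_sum_list_conv_sum_set_nat atLeast0LessThan)
  moreover have "int P * (\<Sum>t<?q. ?f t) = int ?q * (\<Sum>t<P. ?f t)"
    using mult[OF g_period, of P] mult[of P ?q] assms(2) by (simp add: g_nth mult.commute)
  ultimately show ?thesis by simp
qed

end

end


section \<open>Pure and nested gliders\<close>

context normalized_flow
begin

lemma
  assumes "periodic g" "0 < P" "\<And>t. S (t + P) = S t"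
  shows positive_speed_iff: "positive_speed g \<longleftrightarrow> pos P 0 < pos 0 0"
    and negative_speed_iff: "negative_speed g \<longleftrightarrow> pos 0 0 < pos P 0"
proof -
  have "0 < int (length (per g))" "0 < int P" using per_props[OF assms(1)] assms(2) by auto
  moreover have "int P * fst (speed g) = int (length (per g)) * (pos 0 0 - pos P 0)"
    by (rule speed_period[OF assms])
  ultimately have "sgn (fst (speed g)) = sgn (pos 0 0 - pos P 0)"
    by (metis mult.left_neutral sgn_1_pos sgn_mult)
  then show "positive_speed g \<longleftrightarrow> pos P 0 < pos 0 0" "negative_speed g \<longleftrightarrow> pos 0 0 < pos P 0"
    unfolding positive_speed_def negative_speed_def
    by (metis diff_gt_0_iff_gt sgn_greater, metis diff_less_0_iff_less sgn_less)
qed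

lemma gliderI:
  assumes "turning_rule_of r g" "periodic g" "0 < P" "\<And>t. S (t + P) = S t" "tight" "pos P 0 \<noteq> pos 0
      0"
  shows "glider n g"
  using sca null_chain_gap[OF assms(2)] positive_speed_iff[OF assms(2-4)] negative_speed_iff[OF
      assms(2-4)] assms
  unfolding glider_def repeating_sca_pattern_def by (metis linorder_neqE_linordered_idom)

lemma tight_if_glider: "glider n g \<Longrightarrow> tight"
  using gap_null_chain by (auto simp: glider_def repeating_sca_pattern_def)

end

lemma smap_cycle: "a \<noteq> [] \<Longrightarrow> smap f (cycle a) = cycle (map f a)"
  by (coinduction arbitrary: a) (auto simp: hd_map map_tl intro!: exI[of _ "tl _ @ [hd _]"])

text \<open>Generations of a grid pattern start at 0, so \<open>g\<close> is its own normal form;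
  the offset is the one in \<open>child_pos\<close>.\<close>

lemma pattern_flow:
  assumes grid: "grid_pattern n g" and cont: "continuous_pattern g" and nc: "non_crossing g"
  shows "normalized_flow ((!!) g) (\<lambda>t. of_bool (exits_left ((g !! t) 0))) n g"
proof -
  have gen: "is_generation n (g !! t)" for t using grid by (simp add: grid_pattern_def)
  have fin: "finite (keys (g !! t))" for t
  proof -
    have "keys (g !! t) \<subseteq> (\<Union>j\<in>{j. (g !! t) j \<noteq> N_N}. {2 * j, 2 * j + 1})"
    proof
      fix \<kappa> assume "\<kappa> \<in> keys (g !! t)"
      moreover from this have "(g !! t) (\<kappa> div 2) \<noteq> N_N" by (rule key_nonempty)
      moreover have "\<kappa> = 2 * (\<kappa> div 2) \<or> \<kappa> = 2 * (\<kappa> div 2) + 1" by presburger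
      ultimately show "\<kappa> \<in> (\<Union>j\<in>{j. (g !! t) j \<noteq> N_N}. {2 * j, 2 * j + 1})" by blast
    qed
    then show ?thesis by (rule finite_subset) (use gen[of t] in \<open>simp add: is_generation_def\<close>)
  qed
  have card: "card (keys (g !! t)) = n" for t
    using gen[of t] strands_in_eq_card[OF fin, of t UNIV] by (simp add: is_generation_def)
  have child: "child g t k = (g !! Suc t) (k + of_bool (exits_left ((g !! t) 0)))" for t k
    by (simp add: child_def child_pos_def)
  have "\<exists>\<kappa>. \<kappa> \<in> keys (g !! 0)"
    using gen[of 0] nonempty_key[of "g !! 0" 0] by (auto simp: is_generation_def)
  then have n: "0 < n" using card[of 0] fin[of 0] by (metis card_gt_0_iff empty_iff)
  have "Min {j. (g !! t) j \<noteq> N_N} = 0" for t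
    using gen[of t] by (intro Min_eqI) (force simp: is_generation_def not_less[symmetric])+
  then have "g !! t = normalize_gen (g !! t)" for t by (simp add: normalize_gen_def)
  then show ?thesis
    using cont nc fin card n unfolding continuous_pattern_def non_crossing_def child
    by unfold_locales auto
qed

section \<open>Non-crossing gliders and their subpatterns\<close>

locale noncrossing_glider =
  fixes n :: nat and g :: pattern
  assumes glider: "glider n g" and noncrossing: "non_crossing g"
begin

sublocale normalized_flow "(!!) g" "\<lambda>t. of_bool (exits_left ((g !! t) 0))" n g
  using glider noncrossing
  by (intro pattern_flow) (auto simp: glider_def repeating_sca_pattern_def sca_pattern_def)

abbreviation period :: nat where
  "period \<equiv> length (per g)"

lemma periodic_g: "periodic g"
  using glider by (simp add: glider_def repeating_sca_pattern_def)

lemma period_pos: "0 < period"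
  using per_props[OF periodic_g] by simp

lemmas g_period' = g_period[OF periodic_g]

lemma pos_displacement: "pos period i - pos 0 i = off period"
proof -
  have "key period i = key 0 i" using g_period'[of 0] by (simp add: key_def)
  then show ?thesis by (simp add: pos_def)
qed

lemma positive_iff: "positive_speed g \<longleftrightarrow> off period < 0"
  using positive_speed_iff[OF periodic_g period_pos g_period'] pos_displacement[of 0] by linarith

lemma negative_iff: "negative_speed g \<longleftrightarrow> 0 < off period"
  using negative_speed_iff[OF periodic_g period_pos g_period'] pos_displacement[of 0] by linarith

lemma speed_cases: "off period < 0 \<and> positive_speed g \<and> \<not> negative_speed g \<or>
    0 < off period \<and> negative_speed g \<and> \<not> positive_speed g"
  using glider positive_iff negative_iff by (auto simp: glider_def)

lemma rule_obeys: "turning_rule_of r g \<longleftrightarrow> turning_rule r \<and> obeys (\<lambda>A B. r ! bit_index A B)"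
  by (rule turning_rule_iff)

lemma strands: "obeys turns \<Longrightarrow> strand_system n turns pos kind period (- off period)"
  by (rule strand_system) (use period_pos g_period' in auto)

context
  fixes lo hi :: nat and h :: pattern and f :: "generation \<Rightarrow> generation"
  assumes range: "lo < hi" "hi \<le> n"
    and h: "h = smap f g" "\<And>t. h !! t = normalize_gen (part lo hi t)"
begin
interpretation part: normalized_flow "part lo hi" "\<lambda>t. of_bool (exits_left ((g !! t) 0))" "hi - lo"
    h
  by (intro normalized_flow.intro part_flow normalized_flow_axioms.intro) (use range h in auto)

lemma part_period: "part lo hi (t + period) = part lo hi t"
  using g_period'[of t] by (simp add: part_def key_def)

lemma part_rule_iff: "turning_rule_of r h \<longleftrightarrow> turning_rule r \<and> part.obeys (\<lambda>A B. r ! bit_index A B)"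
  by (rule part.turning_rule_iff)

lemma part_strands:
  "part.obeys turns \<Longrightarrow> strand_system (hi - lo) turns part.pos part.kind period (- off period)"
  by (rule part.strand_system) (use period_pos g_period' part_period in auto)

text \<open>Tightness and nonzero displacement are inherited from \<open>g\<close>, so a turning
  rule is all that remains to be found.\<close>

lemma part_glider:
  assumes "turning_rule_of r h"
  shows "glider (hi - lo) h"
proof (rule part.gliderI[OF assms _ period_pos part_period])
  obtain a where "a \<noteq> []" "g = cycle a" using periodic_g by (auto simp: periodic_def)
  then have "map f a \<noteq> []" "h = cycle (map f a)" using h(1) by (auto simp: smap_cycle)
  then show "periodic h" by (auto simp: periodic_def)
  have "part.gap_width t i = gap_width t (lo + i)" if "Suc i < hi - lo" for t i
    using that range part_key[of lo hi] by (simp add: part.gap_width_def gap_width_def)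
  moreover have "Suc (lo + i) < n" if "Suc i < hi - lo" for i using that range by linarith
  ultimately show "part.tight"
    using tight_if_glider[OF glider] unfolding part.tight_def tight_def by simp
  show "part.pos period 0 \<noteq> part.pos 0 0"
    using part_pos[of lo hi 0] range pos_displacement[of lo] speed_cases by auto
qed

end

lemma left_subpattern_nth: "k \<le> n \<Longrightarrow> left_subpattern k g !! t = normalize_gen (part 0 k t)"
  using first_strands_eq_part[of k t] by (simp add: left_subpattern_def)

lemma right_subpattern_nth: "k \<le> n \<Longrightarrow> right_subpattern k g !! t = normalize_gen (part (n - k) n t)"
  using last_strands_eq_part[of k t] by (simp add: right_subpattern_def)

text \<open>\<open>no_TR\<close> supplies what \<open>part_obeys\<close> requires at the last
  remaining strand.\<close>

lemma left_nested:
  assumes "off period < 0" and r: "turning_rule_of r g" "\<not> r ! 1" and k: "k \<in> {1..n}"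
  shows "turning_rule_of r (left_subpattern k g) \<and> glider k (left_subpattern k g)"
proof -
  let ?turns = "\<lambda>A B. r ! bit_index A B"
  have obeys: "obeys ?turns" using r rule_obeys by blast
  interpret strand_system n ?turns pos kind period "- off period" by (rule strands[OF obeys])
  interpret left_moving_SE n ?turns pos kind period "- off period"
    using assms by unfold_locales (auto simp: bit_index_def)
  have range: "0 < k" "k \<le> n" using k by auto
  note sub = range left_subpattern_def[of _ g] left_subpattern_nth[OF range(2)]
  have "flow.obeys (part 0 k) (\<lambda>t. of_bool (exits_left ((g !! t) 0))) ?turns"
    using range r no_TR by (intro part_obeys obeys) (auto simp: bit_index_def)
  then have "turning_rule_of r (left_subpattern k g)"
    using part_rule_iff[OF sub] r rule_obeys by blast
  then show ?thesis using part_glider[OF sub] by simp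
qed

lemma right_nested:
  assumes "0 < off period" and r: "turning_rule_of r g" "\<not> r ! 3" and k: "k \<in> {1..n}"
  shows "turning_rule_of r (right_subpattern k g) \<and> glider k (right_subpattern k g)"
proof -
  let ?turns = "\<lambda>A B. r ! bit_index A B"
  have obeys: "obeys ?turns" using r rule_obeys by blast
  interpret strand_system n ?turns pos kind period "- off period" by (rule strands[OF obeys])
  \<comment> \<open>In the mirror image the motion is to the left and the bit \<open>ES\<close>
    takes the place of \<open>SE\<close>.\<close>
  interpret mirrored: left_moving_SE n "\<lambda>A B. ?turns B A" "\<lambda>t i. - pos t (n - Suc i)"
      "\<lambda>t i. mirror_strand (kind t (n - Suc i))" period "- (- off period)"
    using assms mirror by (intro left_moving_SE.intro left_moving.intro left_moving_axioms.intro
      left_moving_SE_axioms.intro) (auto simp: bit_index_def)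
  have no_TL: "kind t i \<noteq> TL" if "i < n" for t i
    using mirrored.no_TR[of "n - Suc i" t] that by simp
  have range: "n - k < n" "n \<le> n" "k \<le> n" using k by auto
  note sub = range(1,2) right_subpattern_def[of _ g] right_subpattern_nth[OF range(3)]
  have "flow.obeys (part (n - k) n) (\<lambda>t. of_bool (exits_left ((g !! t) 0))) ?turns"
    using range r no_TL by (intro part_obeys obeys) (auto simp: bit_index_def)
  then have "turning_rule_of r (right_subpattern k g)"
    using part_rule_iff[OF sub] r rule_obeys by blast
  then show ?thesis using part_glider[OF sub] range by simp
qed

lemma left_pure:
  assumes "off period < 0" and sub_glider: "glider 1 (left_subpattern 1 g)"
  shows "\<exists>r. turning_rule_of r g \<and> \<not> r ! 1"
proof -
  obtain r where r: "turning_rule_of r g"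
    using glider by (auto simp: glider_def repeating_sca_pattern_def sca_pattern_def)
  obtain r1 where r1: "turning_rule_of r1 (left_subpattern 1 g)"
    using sub_glider by (auto simp: glider_def repeating_sca_pattern_def sca_pattern_def)
  let ?turns = "\<lambda>A B. r ! bit_index A B" and ?turns1 = "\<lambda>A B. r1 ! bit_index A B"
  let ?e = "\<lambda>t. of_bool (exits_left ((g !! t) 0))"
  have obeys: "obeys ?turns" using r rule_obeys by blast
  interpret strand_system n ?turns pos kind period "- off period" by (rule strands[OF obeys])
  interpret left_moving n ?turns pos kind period "- off period"
    using assms by unfold_locales auto
  have range: "0 < (1::nat)" "1 \<le> n" using n_pos by auto
  note sub = range left_subpattern_def[of _ g] left_subpattern_nth[OF range(2)]
  have "flow.obeys (part 0 1) ?e ?turns1" using part_rule_iff[OF sub] r1 by blast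
  from part_strands[OF sub this]
  interpret single: strand_system 1 ?turns1 "flow.pos (part 0 1) ?e" "flow.kind (part 0 1)" period
      "- off period"
    by simp
  interpret single: left_moving 1 ?turns1 "flow.pos (part 0 1) ?e" "flow.kind (part 0 1)" period "-
      off period"
    using assms by unfold_locales auto
  \<comment> \<open>The rules \<open>r\<close> and \<open>r1\<close> may differ, but the first
    strand has the same types in \<open>g\<close> and in its subpattern.\<close>
  have kind0: "flow.kind (part 0 1) t 0 = kind t 0" for t using part_kind[of 0 1 0 t] range by simp
  consider "\<forall>t. kind t 0 = TL" | "cyclic 0"
    using single.single_strand unfolding single.cyclic_def cyclic_def kind0 by blast
  then show ?thesis
  proof cases
    \<comment> \<open>All strands are always \<open>TL\<close>, so no straight strand is ever a
      parent and bit 1 of \<open>r\<close> can be cleared.\<close>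
    case 1
    then have TL: "kind t i = TL" if "i < n" for t i using all_TL[of 0 i t] n_pos that by blast
    have "obeys (\<lambda>A B. r[1 := False] ! bit_index A B)"
    proof (rule obeysI)
      fix t i assume "i < n"
      then show "kind (Suc t) i = (if r[1 := False] ! bit_index (left_state pos kind t i)
          (strand_state (kind t i)) then TL else SR)"
        using ty_Suc_left[of i t] TL by (simp add: bit_index_def nth_list_update)
    qed (simp add: TL)
    moreover have "turning_rule (r[1 := False])" "\<not> r[1 := False] ! 1"
      using r by (auto simp: turning_rule_of_def turning_rule_def nth_list_update)
    ultimately show ?thesis using rule_obeys by blast
  next
    case 2
    then have "\<not> r ! 1" using cyclic_not_SE n_pos by (simp add: bit_index_def)
    then show ?thesis using r by blast
  qed
qed

text \<open>The mirror image of \<open>left_pure\<close>, in which the last strand plays the part of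
  the first.\<close>

lemma right_pure:
  assumes "0 < off period" and sub_glider: "glider 1 (right_subpattern 1 g)"
  shows "\<exists>r. turning_rule_of r g \<and> \<not> r ! 3"
proof -
  obtain r where r: "turning_rule_of r g"
    using glider by (auto simp: glider_def repeating_sca_pattern_def sca_pattern_def)
  obtain r1 where r1: "turning_rule_of r1 (right_subpattern 1 g)"
    using sub_glider by (auto simp: glider_def repeating_sca_pattern_def sca_pattern_def)
  let ?turns = "\<lambda>A B. r ! bit_index A B" and ?turns1 = "\<lambda>A B. r1 ! bit_index A B"
  let ?e = "\<lambda>t. of_bool (exits_left ((g !! t) 0))"
  let ?S = "part (n - 1) n"
  have obeys: "obeys ?turns" using r rule_obeys by blast
  interpret strand_system n ?turns pos kind period "- off period" by (rule strands[OF obeys])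
  interpret mirrored: left_moving n "\<lambda>A B. ?turns B A" "\<lambda>t i. - pos t (n - Suc i)"
      "\<lambda>t i. mirror_strand (kind t (n - Suc i))" period "- (- off period)"
    using assms mirror by (intro left_moving.intro left_moving_axioms.intro) auto
  have range: "n - 1 < n" "n \<le> n" "1 \<le> n" using n_pos by auto
  note sub = range(1,2) right_subpattern_def[of _ g] right_subpattern_nth[OF range(3)]
  have "flow.obeys ?S ?e ?turns1" using part_rule_iff[OF sub] r1 by blast
  from part_strands[OF sub this]
  interpret single: strand_system 1 ?turns1 "flow.pos ?S ?e" "flow.kind ?S" period "- off period"
    using range by simp
  interpret last: left_moving 1 "\<lambda>A B. ?turns1 B A" "\<lambda>t i. - flow.pos ?S ?e t (1 - Suc i)"
      "\<lambda>t i. mirror_strand (flow.kind ?S t (1 - Suc i))" period "- (- off period)"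
    using assms single.mirror by (intro left_moving.intro left_moving_axioms.intro) auto
  have kind0: "flow.kind ?S t (1 - Suc 0) = kind t (n - Suc 0)" for t
    using part_kind[of "n - 1" n 0 t] range by simp
  consider "\<forall>t. kind t (n - Suc 0) = TR" | "mirrored.cyclic 0"
    using last.single_strand unfolding last.cyclic_def mirrored.cyclic_def kind0 mirror_strand_eq
      by blast
  then show ?thesis
  proof cases
    case 1
    then have TR: "kind t i = TR" if "i < n" for t i
      using mirrored.all_TL[of 0 "n - Suc i" t] n_pos that by simp
    have "obeys (\<lambda>A B. r[3 := False] ! bit_index A B)"
    proof (rule obeysI)
      fix t i assume "i < n"
      then show "kind (Suc t) i = (if r[3 := False] ! bit_index (strand_state (kind t i))
          (right_state n pos kind t i) then TR else SL)"
        using ty_Suc_right[of i t] TR by (simp add: bit_index_def nth_list_update)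
    qed (simp add: TR)
    moreover have "turning_rule (r[3 := False])" "\<not> r[3 := False] ! 3"
      using r by (auto simp: turning_rule_of_def turning_rule_def nth_list_update)
    ultimately show ?thesis using rule_obeys by blast
  next
    case 2
    then have "\<not> r ! 3" using mirrored.cyclic_not_SE n_pos by (simp add: bit_index_def)
    then show ?thesis using r by blast
  qed
qed

end

theorem theorem7p19:
  fixes n :: nat and g :: pattern
  assumes "glider n g" and "non_crossing g"
  shows "(pure_glider n g \<longleftrightarrow> nested_glider_under_rule n g) \<and>
         (nested_glider_under_rule n g \<longleftrightarrow> nested_glider n g)"
proof -
  interpret noncrossing_glider n g using assms by unfold_locales
  have one: "1 \<in> {1..n}" using n_pos by simp
  have "pure_glider n g \<Longrightarrow> nested_glider_under_rule n g"
    using speed_cases left_nested right_nested assms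
    unfolding pure_glider_def nested_glider_under_rule_def nested_glider_def by metis
  moreover have "nested_glider_under_rule n g \<Longrightarrow> nested_glider n g"
    by (simp add: nested_glider_under_rule_def)
  moreover have "nested_glider n g \<Longrightarrow> pure_glider n g"
    using speed_cases left_pure right_pure one assms
    unfolding pure_glider_def nested_glider_def by blast
  ultimately show ?thesis by blast
qed

end
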